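(* Let $0<\delta<1$. For every $\delta'\in(0,\delta)$ there is a constant $C(\delta')>0$ such that for every function $u\in \mathrm{H}^{1+\delta}(S^1)$ and every $\mathrm{W}^{1,\infty}$ diffeomorphism $\phi$ of $S^1$, $$\|u\circ\phi-u\|_{\mathrm{H}^{1/2}(S^1)}\le C(\delta')\,\|u\|_{\mathrm{H}^{1+\delta}(S^1)}\;\omega_{\delta'}\big(\|\phi-I\|_{\mathrm{W}^{1,\infty}(S^1)}\big),$$ where $\omega_{\delta'}(t)=\max\big(t^{\delta'+1/2},\,t^{\delta'}\big)$ for $t\ge0$.
   Context: Functions on $S^1$ are viewed as $2\pi$-periodic functions of $\theta$, with Fourier coefficients $c_n(u)$, $u(\theta)=\sum_{n\in\mathbb{Z}}c_n(u)e^{in\theta}$. $\mathrm{H}^{1/2}(S^1)$ is considered modulo constants with norm $\|u\|_{\mathrm{H}^{1/2}(S^1)}=\big(\sum_{n}|n||c_n(u)|^2\big)^{1/2}$; $\mathrm{H}^{s}(S^1)$ for $s>1/2$ is the usual Sobolev space with norm $\big(\sum_n(1+|n|^2)^{s}|c_n(u)|^2\big)^{1/2}$. A $\mathrm{W}^{1,\infty}$ diffeomorphism $\phi$ of $S^1$ is an orientation-preserving homeomorphism which, together with its inverse, is Lipschitz; it is identified with a lift $\phi:\mathbb{R}\to\mathbb{R}$ satisfying $\phi(\theta+2\pi)=\phi(\theta)+2\pi$, so that $\phi-I$ ($I$ the identity) is a $2\pi$-periodic Lipschitz function, and $\|\psi\|_{\mathrm{W}^{1,\infty}(S^1)}=\|\psi\|_{L^\infty}+\|\psi'\|_{L^\infty}$.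 *)

theory Defs
  imports "HOL-Analysis.Analysis" "HOL-Probability.Essential_Supremum"
begin

text \<open>
  Functions on the circle are \<open>2 * pi\<close>-periodic functions on the real line, and one period,
  \<open>{0..2 * pi}\<close>, carries the measure.  A function space on the circle consists of classes modulo
  equality almost everywhere; its membership predicate below is satisfied by every periodic
  representative of such a class.
\<close>

abbreviation circle_measure :: "real measure" where
  "circle_measure \<equiv> lebesgue_on {0..2 * pi}"

definition periodic_2pi :: "(real \<Rightarrow> 'a) \<Rightarrow> bool" where
  "periodic_2pi u \<longleftrightarrow> (\<forall>\<theta>. u (\<theta> + 2 * pi) = u \<theta>)"

definition L2_circle :: "(real \<Rightarrow> complex) set" where
  "L2_circle = {u. periodic_2pi u \<and> u \<in> borel_measurable circle_measure \<and>
     integrable circle_measure (\<lambda>\<theta>. (norm (u \<theta>))\<^sup>2)}"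

definition fourier_coeff :: "(real \<Rightarrow> complex) \<Rightarrow> int \<Rightarrow> complex" where
  "fourier_coeff u n =
     (1 / (2 * pi)) *\<^sub>R (LINT \<theta>|circle_measure. u \<theta> * cis (- (of_int n * \<theta>)))"

definition H_space :: "real \<Rightarrow> (real \<Rightarrow> complex) set" where
  "H_space s = {u \<in> L2_circle.
     (\<lambda>n::int. (1 + (of_int \<bar>n\<bar>)\<^sup>2) powr s * (norm (fourier_coeff u n))\<^sup>2) summable_on UNIV}"

definition H_norm :: "real \<Rightarrow> (real \<Rightarrow> complex) \<Rightarrow> real" where
  "H_norm s u =
     sqrt (\<Sum>\<^sub>\<infinity>n::int. (1 + (of_int \<bar>n\<bar>)\<^sup>2) powr s * (norm (fourier_coeff u n))\<^sup>2)"

text \<open>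
  The space of order one half modulo constants: the members are representatives of the classes,
  and the norm does not see the coefficient of index \<open>0\<close>.
\<close>

definition H_half_space :: "(real \<Rightarrow> complex) set" where
  "H_half_space = {u \<in> L2_circle.
     (\<lambda>n::int. of_int \<bar>n\<bar> * (norm (fourier_coeff u n))\<^sup>2 :: real) summable_on UNIV}"

definition H_half_norm :: "(real \<Rightarrow> complex) \<Rightarrow> real" where
  "H_half_norm u = sqrt (\<Sum>\<^sub>\<infinity>n::int. of_int \<bar>n\<bar> * (norm (fourier_coeff u n))\<^sup>2)"

text \<open>
  A diffeomorphism of the circle is given by a lift to the real line; it preserves the orientation
  iff the lift is increasing.
\<close>

definition W1inf_diffeo :: "(real \<Rightarrow> real) \<Rightarrow> bool" where
  "W1inf_diffeo \<phi> \<longleftrightarrow>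
     (\<forall>\<theta>. \<phi> (\<theta> + 2 * pi) = \<phi> \<theta> + 2 * pi) \<and>
     homeomorphism UNIV UNIV \<phi> (inv \<phi>) \<and> strict_mono \<phi> \<and>
     (\<exists>L. L-lipschitz_on UNIV \<phi>) \<and> (\<exists>L. L-lipschitz_on UNIV (inv \<phi>))"

definition Linf_norm :: "(real \<Rightarrow> real) \<Rightarrow> real" where
  "Linf_norm \<psi> = real_of_ereal (esssup circle_measure (\<lambda>\<theta>. ereal \<bar>\<psi> \<theta>\<bar>))"

text \<open>
  Meant for periodic Lipschitz functions.  They are differentiable almost everywhere with a bounded
  derivative, so the value of \<^const>\<open>deriv\<close> on the exceptional null set is irrelevant and both
  essential suprema are finite.
\<close>

definition W1inf_norm :: "(real \<Rightarrow> real) \<Rightarrow> real" where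
  "W1inf_norm \<psi> = Linf_norm \<psi> + Linf_norm (deriv \<psi>)"

definition omega :: "real \<Rightarrow> real \<Rightarrow> real" where
  "omega d t = max (t powr (d + 1 / 2)) (t powr d)"

end

theory Submission
  imports Defs
begin

text \<open>
  Since \<open>\<bar>n\<bar> \<le> n\<^sup>2\<close>, the \<open>H\<close>-one-half norm of \<open>w = u \<circ> \<phi> - u\<close> is at most the
  norm in \<open>L\<^sup>2\<close> of \<open>w' = (u' \<circ> \<phi>) \<phi>' - u'\<close>.  Let \<open>t\<close> be the norm of \<open>\<phi> - I\<close>.
  For large \<open>t\<close>, the substitution \<open>\<phi>' \<le> 1 + t\<close> bounds \<open>w'\<close> by \<open>(1 + t)\<^bsup>1/2\<^esup>\<close> times the norm of \<open>u'\<close>.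
  For small \<open>t\<close>, \<open>w' = (\<phi>' - 1) (u' \<circ> \<phi>) + (u' \<circ> \<phi> - u')\<close>, and splitting \<open>u'\<close> at the frequency
  \<open>1 / t\<close> bounds the last difference by \<open>t\<^bsup>\<delta>\<^esup>\<close> times the norm of \<open>u\<close>.  It suffices to treat
  trigonometric polynomials \<open>u\<close>, with constants independent of the degree, because each Fourier
  coefficient of \<open>w\<close> passes to the limit.

  Only \<open>deriv\<close> of the displacement is controlled by the hypothesis, so \<open>\<phi>\<close> has to be shown to be
  differentiable almost everywhere.  Being Lipschitz, \<open>\<phi>\<close> maps null sets to null sets; the
  Radon--Nikodym theorem therefore gives it a density, whose indefinite integral is differentiable
  almost everywhere.
\<close>

subsection \<open>Almost everywhere derivatives of Lipschitz functions\<close>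

text \<open>The two regimes differ in what composition with \<open>\<phi>\<close> costs in the L2
  norm. If the displacement is at most 1/2, then \<phi>' \<ge> 1/2 almost everywhere, and
  composition is bounded with factor 2. For larger displacements \<phi>' may come arbitrarily close
  to 0, so u' o \<phi> alone has no uniform bound. Only its product with \<phi>' is controlled: of
  the two factors in (\<phi>')^2 one is estimated by 1 + t and the other is kept as the Jacobian of
  the substitution. The resulting growth t^(1/2) is the reason for the exponent \<delta>' + 1/2. In
  the small regime the power obtained is t^\<delta>, which is at most t^\<delta>' there; the
  constants stay absolute, and the final one is 8. Polynomials are more than a convenience: u' is in
  general defined only almost everywhere, whereas for a smooth outer function the chain rule holds
  wherever \<open>\<phi>\<close> is differentiable.\<close>

lemma lipschitz_negligible_image:
  fixes f :: "real \<Rightarrow> real"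
  assumes "L-lipschitz_on UNIV f" "negligible S"
  shows "negligible (f ` S)"
proof (rule negligible_locally_Lipschitz_image)
  fix x :: real
  have "norm (f y - f x) \<le> L * norm (y - x)" for y
    using lipschitz_onD[OF assms(1), of y x] by (simp add: dist_norm)
  then show "\<exists>T B. open T \<and> x \<in> T \<and> (\<forall>y\<in>S \<inter> T. norm (f y - f x) \<le> B * norm (y - x))"
    by (intro exI[of _ UNIV] exI[of _ L]) auto
qed (use assms in auto)

text \<open>The length of the image of a set under \<open>\<phi>\<close> is a measure in that set,
  absolutely continuous because null sets have null images. Monotonicity turns the image of [a, b]
  into [\<phi>(a), \<phi>(b)], so the mass of an interval is an increment of
  \<open>\<phi>\<close>.\<close>

lemma increasing_lipschitz_density:
  fixes \<phi> \<psi> :: "real \<Rightarrow> real"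
  assumes hom: "homeomorphism UNIV UNIV \<phi> \<psi>" and mono: "strict_mono \<phi>"
    and lip: "L-lipschitz_on UNIV \<phi>"
  obtains g where "\<And>a b. a \<le> b \<Longrightarrow> (g has_integral (\<phi> b - \<phi> a)) {a..b}"
proof -
  have inv: "\<psi> (\<phi> x) = x" "\<phi> (\<psi> x) = x" for x
    using hom by (auto simp: homeomorphism_def)
  have [measurable]: "\<psi> \<in> borel_measurable borel"
    using hom by (auto simp: homeomorphism_def intro: borel_measurable_continuous_onI)
  have vim: "\<psi> -` A = \<phi> ` A" for A
  proof
    show "\<psi> -` A \<subseteq> \<phi> ` A"
      using inv(2) by (metis image_eqI subsetI vimageE)
    show "\<phi> ` A \<subseteq> \<psi> -` A"
      using inv(1) by auto
  qed
  \<comment> \<open>Pushing Lebesgue measure forward by the inverse makes the measure property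
    automatic; \<open>vim\<close> identifies the value on \<open>A\<close> as the length of the
    image of \<open>A\<close>.\<close>
  define M where "M = distr lborel borel \<psi>"
  have emM: "emeasure M A = emeasure lborel (\<phi> ` A)" if "A \<in> sets borel" for A
    using that unfolding M_def by (subst emeasure_distr) (auto simp: vim)
  have "absolutely_continuous lborel M"
    unfolding absolutely_continuous_def
  proof
    fix A :: "real set" assume A: "A \<in> null_sets lborel"
    then have "negligible A"
      by (simp add: negligible_iff_null_sets null_sets_completionI)
    then have "negligible (\<phi> ` A)"
      by (rule lipschitz_negligible_image[OF lip])
    moreover have "\<phi> ` A \<in> sets borel"
      unfolding vim[symmetric] using A
      by (intro measurable_sets_borel[of \<psi> borel]) auto
    ultimately have "emeasure lborel (\<phi> ` A) = 0"
      by (simp add: negligible_iff_null_sets null_sets_completion_iff null_setsD1)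
    then show "A \<in> null_sets M"
      using A emM[of A] by (auto simp: null_sets_def M_def)
  qed
  moreover have "sets M = sets lborel"
    by (simp add: M_def)
  ultimately obtain f where f[measurable]: "f \<in> borel_measurable lborel" and fM: "density lborel f = M"
    using sigma_finite_measure.Radon_Nikodym[OF sigma_finite_lborel] by blast
  have img: "\<phi> ` {a..b} = {\<phi> a..\<phi> b}" for a b
  proof
    show "\<phi> ` {a..b} \<subseteq> {\<phi> a..\<phi> b}"
      using mono by (auto simp: strict_mono_less_eq)
    show "{\<phi> a..\<phi> b} \<subseteq> \<phi> ` {a..b}"
    proof
      fix y assume "y \<in> {\<phi> a..\<phi> b}"
      then have "\<psi> y \<in> {a..b}"
        using strict_mono_less_eq[OF mono, of a "\<psi> y"] strict_mono_less_eq[OF mono, of "\<psi> y" b]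
        by (simp add: inv)
      then show "y \<in> \<phi> ` {a..b}"
        using inv by (metis imageI)
    qed
  qed
  have nnf: "(\<integral>\<^sup>+x. f x * indicator {a..b} x \<partial>lborel) = ennreal (\<phi> b - \<phi> a)" if "a \<le> b" for a b
  proof -
    have "(\<integral>\<^sup>+x. f x * indicator {a..b} x \<partial>lborel) = emeasure M {a..b}"
      unfolding fM[symmetric] by (subst emeasure_density) auto
    also have "\<dots> = ennreal (\<phi> b - \<phi> a)"
      using that mono by (simp add: emM img strict_mono_less_eq)
    finally show ?thesis .
  qed
  \<comment> \<open>The density may take the value \<infinity>. Its integral over each [-n, n] is
    finite, so this happens only on a null set and \<open>enn2real\<close> changes no
    integral.\<close>
  have fin: "AE x in lborel. f x \<noteq> \<infinity>"
  proof -
    have "AE x in lborel. \<forall>n::nat. f x * indicator {-real n..real n} x \<noteq> \<infinity>"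
      unfolding AE_all_countable
    proof (intro allI nn_integral_PInf_AE)
      fix n :: nat
      show "(\<integral>\<^sup>+x. f x * indicator {-real n..real n} x \<partial>lborel) \<noteq> \<infinity>"
        using nnf[of "-real n" "real n"] by simp
    qed auto
    then show ?thesis
    proof eventually_elim
      case (elim x)
      obtain n where "\<bar>x\<bar> \<le> real n"
        using real_arch_simple by blast
      then have "x \<in> {-real n..real n}"
        by auto
      then show ?case
        using elim[rule_format, of n] by simp
    qed
  qed
  show thesis
  proof (rule that[of "\<lambda>x. enn2real (f x)"])
    fix a b :: real assume "a \<le> b"
    have "((\<lambda>x. enn2real (f x) * indicator {a..b} x) has_integral (\<phi> b - \<phi> a)) UNIV"
    proof (rule nn_integral_has_integral)
      have "(\<integral>\<^sup>+x. ennreal (enn2real (f x) * indicator {a..b} x) \<partial>lborel)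
          = (\<integral>\<^sup>+x. f x * indicator {a..b} x \<partial>lborel)"
      proof (rule nn_integral_cong_AE)
        show "AE x in lborel. ennreal (enn2real (f x) * indicator {a..b} x) = f x * indicator {a..b} x"
          using fin
        proof eventually_elim
          case (elim x)
          then have "ennreal (enn2real (f x)) = f x"
            by (auto simp: less_top)
          then show ?case
            by (cases "x \<in> {a..b}") auto
        qed
      qed
      then show "(\<integral>\<^sup>+x. ennreal (enn2real (f x) * indicator {a..b} x) \<partial>lborel) = ennreal (\<phi> b - \<phi> a)"
        using nnf[OF \<open>a \<le> b\<close>] by simp
      show "0 \<le> \<phi> b - \<phi> a"
        using mono \<open>a \<le> b\<close> by (simp add: strict_mono_less_eq)
    qed auto
    moreover have "(\<lambda>x. enn2real (f x) * indicator {a..b} x) = (\<lambda>x. if x \<in> {a..b} then enn2real (f x) else 0)"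
      by auto
    ultimately show "((\<lambda>x. enn2real (f x)) has_integral (\<phi> b - \<phi> a)) {a..b}"
      using has_integral_restrict_UNIV by metis
  qed
qed

text \<open>Lebesgue differentiation is applied to boxes with lower corner \<open>x\<close>, which
  control only the increments to the right of \<open>x\<close>.\<close>

lemma AE_derivative_of_density_right:
  fixes F g :: "real \<Rightarrow> real"
  assumes int: "\<And>a b. a \<le> b \<Longrightarrow> (g has_integral (F b - F a)) {a..b}"
  shows "AE x in lebesgue. ((\<lambda>y. (F y - F x) / (y - x)) \<longlongrightarrow> g x) (at_right x)"
proof -
  have "g integrable_on cbox a b" for a b
    using int[of a b] by (cases "a \<le> b") (auto simp: has_integral_integrable)
  then obtain N where "negligible N" and N: "\<And>x e. \<lbrakk>x \<notin> N; 0 < e\<rbrakk> \<Longrightarrow>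
      \<exists>d>0. \<forall>h. 0 < h \<and> h < d \<longrightarrow> norm (integral (cbox x (x + h *\<^sub>R One)) g /\<^sub>R h ^ DIM(real) - g x) < e"
    using integrable_ccontinuous_explicit[of g] by blast
  show ?thesis
  proof (rule AE_I')
    show "N \<in> null_sets lebesgue"
      using \<open>negligible N\<close> negligible_iff_null_sets by blast
    have "((\<lambda>y. (F y - F x) / (y - x)) \<longlongrightarrow> g x) (at_right x)" if "x \<notin> N" for x
    proof (rule tendstoI)
      fix e :: real assume "0 < e"
      then obtain d where "d > 0" and d: "\<And>h. 0 < h \<Longrightarrow> h < d \<Longrightarrow>
          \<bar>integral {x..x + h} g / h - g x\<bar> < e"
        using N[OF \<open>x \<notin> N\<close> \<open>0 < e\<close>] by (auto simp: field_simps)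
      have "dist ((F y - F x) / (y - x)) (g x) < e" if "x < y" "y < x + d" for y
        using d[of "y - x"] int[of x y] that by (simp add: dist_real_def integral_unique)
      then show "\<forall>\<^sub>F y in at_right x. dist ((F y - F x) / (y - x)) (g x) < e"
        unfolding eventually_at_right_field using \<open>d > 0\<close> by (intro exI[of _ "x + d"]) auto
    qed
    then show "{x \<in> space lebesgue. \<not> ((\<lambda>y. (F y - F x) / (y - x)) \<longlongrightarrow> g x) (at_right x)} \<subseteq> N"
      by auto
  qed
qed

text \<open>The reflected function x \<mapsto> -F(-x) has density x \<mapsto> g(-x), so its right
  derivatives are the left derivatives of \<open>F\<close>. The exceptional null set has to be
  reflected too.\<close>

lemma AE_derivative_of_density:
  fixes F g :: "real \<Rightarrow> real"
  assumes int: "\<And>a b. a \<le> b \<Longrightarrow> (g has_integral (F b - F a)) {a..b}"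
  shows "AE x in lebesgue. (F has_real_derivative g x) (at x)"
proof -
  have "((\<lambda>x. g (- x)) has_integral (- F (- b) - - F (- a))) {a..b}" if "a \<le> b" for a b
    using has_integral_reflect_real[where f = g and i = "F (-a) - F (-b)" and a = "-b" and b = "-a"] int[of "-b" "-a"] that
    by (simp del: has_integral_reflect_real)
  then have "AE x in lebesgue. ((\<lambda>y. (- F (- y) - - F (- x)) / (y - x)) \<longlongrightarrow> g (- x)) (at_right x)"
    by (rule AE_derivative_of_density_right)
  then obtain N where N: "negligible N" "\<And>x. x \<notin> N \<Longrightarrow>
      ((\<lambda>y. (- F (- y) - - F (- x)) / (y - x)) \<longlongrightarrow> g (- x)) (at_right x)"
    unfolding completion.AE_iff_null_sets negligible_iff_null_sets by auto
  have "negligible (uminus ` N)"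
    using N(1) by (intro lipschitz_negligible_image[where L = 1]) (auto intro!: lipschitz_onI simp: dist_real_def)
  then have "AE x in lebesgue. x \<notin> uminus ` N"
    using AE_not_in negligible_iff_null_sets by blast
  moreover have "AE x in lebesgue. ((\<lambda>y. (F y - F x) / (y - x)) \<longlongrightarrow> g x) (at_right x)"
    using int by (rule AE_derivative_of_density_right)
  ultimately show ?thesis
  proof eventually_elim
    case (elim x)
    from elim(1) have "- x \<notin> N"
      by force
    then have "((\<lambda>y. (- F (- y) - - F x) / (y - (- x))) \<longlongrightarrow> g x) (at_right (- x))"
      using N(2)[of "-x"] by simp
    then have "((\<lambda>y. (- F y - - F x) / (- y - (- x))) \<longlongrightarrow> g x) (at_left x)"
      by (subst at_left_minus) (simp add: filterlim_filtermap add.commute)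
    moreover have "(- F y - - F x) / (- y - (- x)) = (F y - F x) / (y - x)" for y
      using minus_divide_divide[of "F y - F x" "y - x"] by simp
    ultimately have "((\<lambda>y. (F y - F x) / (y - x)) \<longlongrightarrow> g x) (at_left x)"
      by (simp only:)
    then show ?case
      unfolding has_field_derivative_iff filterlim_at_split using elim(2) by simp
  qed
qed

lemma increasing_lipschitz_AE_differentiable:
  fixes \<phi> \<psi> :: "real \<Rightarrow> real"
  assumes "homeomorphism UNIV UNIV \<phi> \<psi>" "strict_mono \<phi>" "L-lipschitz_on UNIV \<phi>"
  shows "AE x in lebesgue. (\<phi> has_real_derivative deriv \<phi> x) (at x)"
proof -
  obtain g where "\<And>a b. a \<le> b \<Longrightarrow> (g has_integral (\<phi> b - \<phi> a)) {a..b}"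
    using increasing_lipschitz_density[OF assms] by blast
  then have "AE x in lebesgue. (\<phi> has_real_derivative g x) (at x)"
    by (rule AE_derivative_of_density)
  then show ?thesis
    by eventually_elim (simp add: DERIV_imp_deriv)
qed

section \<open>Difference quotients and the fundamental theorem for Lipschitz functions\<close>

text \<open>Replaces a limit over all increments by one along a sequence, the form in which
  measurability of limits and dominated convergence can be used.\<close>

lemma LIMSEQ_derivative:
  fixes f :: "real \<Rightarrow> 'a::real_normed_vector"
  assumes "(f has_vector_derivative f') (at x)"
  shows "(\<lambda>n. real (Suc n) *\<^sub>R (f (x + 1 / real (Suc n)) - f x)) \<longlonglongrightarrow> f'"
proof -
  have "(\<lambda>h. norm (f (x + h) - f x - h *\<^sub>R f') / norm h) \<midarrow>0\<rightarrow> 0"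
    using assms by (auto simp: has_vector_derivative_def has_derivative_at)
  moreover have "filterlim (\<lambda>n. 1 / real (Suc n)) (at 0) sequentially"
    unfolding filterlim_at using LIMSEQ_inverse_real_of_nat by (auto simp: inverse_eq_divide)
  ultimately have "(\<lambda>n. norm (f (x + 1 / real (Suc n)) - f x - (1 / real (Suc n)) *\<^sub>R f')
      / norm (1 / real (Suc n))) \<longlonglongrightarrow> 0"
    by (rule filterlim_compose)
  moreover have "norm (f (x + 1 / real (Suc n)) - f x - (1 / real (Suc n)) *\<^sub>R f') / norm (1 / real (Suc n))
      = norm (real (Suc n) *\<^sub>R (f (x + 1 / real (Suc n)) - f x) - f')" for n
  proof -
    have "real (Suc n) *\<^sub>R (f (x + 1 / real (Suc n)) - f x) - f'
        = real (Suc n) *\<^sub>R (f (x + 1 / real (Suc n)) - f x - (1 / real (Suc n)) *\<^sub>R f')"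
      by (simp add: scaleR_diff_right del: of_nat_Suc)
    then show ?thesis
      by (simp del: of_nat_Suc)
  qed
  ultimately show ?thesis
    by (simp add: LIM_zero_iff tendsto_norm_zero_iff del: of_nat_Suc)
qed

text \<open>Completeness of Lebesgue measure: a change on a null set preserves measurability.
  Extension by 0 moves the question to the whole space.\<close>

lemma borel_measurable_AE_lebesgue_on:
  fixes f g :: "'a::euclidean_space \<Rightarrow> 'b::euclidean_space"
  assumes f: "f \<in> borel_measurable (lebesgue_on S)" and S: "S \<in> sets lebesgue"
    and ae: "AE x in lebesgue_on S. f x = g x"
  shows "g \<in> borel_measurable (lebesgue_on S)"
proof -
  have "(\<lambda>x. if x \<in> S then f x else 0) \<in> borel_measurable lebesgue"
    using f S by (simp add: borel_measurable_if)
  moreover have "AE x in lebesgue. (if x \<in> S then f x else 0) = (if x \<in> S then g x else 0)"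
    using ae S by (simp add: AE_restrict_space_iff)
  ultimately have "(\<lambda>x. if x \<in> S then g x else 0) \<in> borel_measurable lebesgue"
    by (rule borel_measurable_AE)
  then show ?thesis
    using S by (simp add: borel_measurable_if)
qed

lemma borel_measurable_AE_limit_lebesgue_on:
  fixes f :: "nat \<Rightarrow> 'a::euclidean_space \<Rightarrow> 'b::euclidean_space"
  assumes f: "\<And>n. f n \<in> borel_measurable (lebesgue_on S)" and S: "S \<in> sets lebesgue"
    and ae: "AE x in lebesgue_on S. (\<lambda>n. f n x) \<longlonglongrightarrow> g x"
  shows "g \<in> borel_measurable (lebesgue_on S)"
proof (rule borel_measurable_AE_lebesgue_on[OF borel_measurable_lim_metric[OF f] S])
  show "AE x in lebesgue_on S. lim (\<lambda>n. f n x) = g x"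
    using ae by eventually_elim (simp add: limI)
qed

text \<open>With h = 1 / (n + 1), shifting the variable leaves the mean of \<open>f\<close> over
  [b, b + h] minus the mean over [a, a + h]; continuity gives the limits of the two means.\<close>

lemma difference_quotient_integral_tendsto:
  fixes f :: "real \<Rightarrow> 'a::euclidean_space"
  assumes cont: "continuous_on UNIV f" and "a \<le> b"
  shows "(\<lambda>n. integral {a..b} (\<lambda>x. real (Suc n) *\<^sub>R (f (x + 1 / real (Suc n)) - f x))) \<longlonglongrightarrow> f b - f a"
proof -
  \<comment> \<open>Starting at a - 1 places \<open>a\<close> and \<open>b\<close> in the interior
    of the region where \<open>G\<close> is differentiated, so its two-sided derivatives are
    available there.\<close>
  define G where "G x = integral {a - 1..x} f" for x
  have cont': "continuous_on {x..y} f" for x y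
    using cont continuous_on_subset by blast
  have int: "f integrable_on {x..y}" for x y
    using cont' integrable_continuous_real by blast
  have derG: "(G has_vector_derivative f x) (at x)" if "x \<in> {a - 1<..<b + 1}" for x
    using integral_has_vector_derivative[OF cont'[of "a - 1" "b + 1"], of x] that
    unfolding G_def by (simp add: at_within_Icc_at)
  have G: "integral {x..y} f = G y - G x" if "a - 1 \<le> x" "x \<le> y" for x y
    using Henstock_Kurzweil_Integration.integral_combine[OF that int] by (simp add: G_def algebra_simps)
  have eq: "integral {a..b} (\<lambda>x. real (Suc n) *\<^sub>R (f (x + 1 / real (Suc n)) - f x)) =
      real (Suc n) *\<^sub>R (G (b + 1 / real (Suc n)) - G b) - real (Suc n) *\<^sub>R (G (a + 1 / real (Suc n)) - G a)" for n
  proof -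
    define h where "h = 1 / real (Suc n)"
    have "h > 0"
      by (simp add: h_def)
    have shift: "integral {a..b} (\<lambda>x. f (x + h)) = integral {a + h..b + h} f"
      using integral_shift[of a h b f] cont' by (simp add: o_def)
    have "continuous_on {a..b} (\<lambda>x. f (x + h))"
      by (intro continuous_on_compose2[OF cont] continuous_intros) auto
    then have "(\<lambda>x. f (x + h)) integrable_on {a..b}"
      by (rule integrable_continuous_real)
    then have "integral {a..b} (\<lambda>x. real (Suc n) *\<^sub>R (f (x + h) - f x))
        = real (Suc n) *\<^sub>R (integral {a + h..b + h} f - integral {a..b} f)"
      using int by (simp add: Henstock_Kurzweil_Integration.integral_diff shift del: of_nat_Suc)
    also have "\<dots> = real (Suc n) *\<^sub>R (G (b + h) - G b) - real (Suc n) *\<^sub>R (G (a + h) - G a)"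
      using \<open>a \<le> b\<close> \<open>h > 0\<close> by (simp add: G algebra_simps del: of_nat_Suc)
    finally show ?thesis
      unfolding h_def .
  qed
  have "(\<lambda>n. real (Suc n) *\<^sub>R (G (b + 1 / real (Suc n)) - G b)
      - real (Suc n) *\<^sub>R (G (a + 1 / real (Suc n)) - G a)) \<longlonglongrightarrow> f b - f a"
    using \<open>a \<le> b\<close> by (intro tendsto_diff LIMSEQ_derivative derG) auto
  then show ?thesis
    by (simp only: eq)
qed

text \<open>The difference quotients are bounded by \<open>L\<close> and converge almost everywhere
  to \<open>f'\<close>, so dominated convergence identifies the integral. Both the substitution
  formula and the integration by parts rest on this.\<close>

lemma lipschitz_AE_derivative_integral:
  fixes f f' :: "real \<Rightarrow> 'a::euclidean_space"
  assumes lip: "L-lipschitz_on UNIV f" and "a \<le> b"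
    and der: "AE x in lebesgue_on {a..b}. (f has_vector_derivative f' x) (at x)"
  shows "integrable (lebesgue_on {a..b}) f'" "(LINT x|lebesgue_on {a..b}. f' x) = f b - f a"
proof -
  let ?M = "lebesgue_on {a..b}"
  define q where "q n x = real (Suc n) *\<^sub>R (f (x + 1 / real (Suc n)) - f x)" for n x
  have cont: "continuous_on UNIV f"
    using lip lipschitz_on_continuous_on by blast
  have contq: "continuous_on {a..b} (q n)" for n
    unfolding q_def by (intro continuous_intros continuous_on_compose2[OF cont]) auto
  then have intq: "integrable ?M (q n)" for n
    by (rule continuous_imp_integrable_real)
  have lim: "AE x in ?M. (\<lambda>n. q n x) \<longlonglongrightarrow> f' x"
    using der by eventually_elim (auto simp: q_def simp del: of_nat_Suc intro: LIMSEQ_derivative)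
  have meas: "f' \<in> borel_measurable ?M"
    by (rule borel_measurable_AE_limit_lebesgue_on[OF borel_measurable_integrable[OF intq] _ lim]) auto
  have bound: "norm (q n x) \<le> L" for n x
  proof -
    have "norm (f (x + 1 / real (Suc n)) - f x) \<le> L * (1 / real (Suc n))"
      using lipschitz_on_normD[OF lip, of "x + 1 / real (Suc n)" x] by simp
    then have "real (Suc n) * norm (f (x + 1 / real (Suc n)) - f x) \<le> real (Suc n) * (L * (1 / real (Suc n)))"
      by (rule mult_left_mono) simp
    then show ?thesis
      by (simp add: q_def del: of_nat_Suc)
  qed
  have const: "integrable ?M (\<lambda>x. L)"
    by (rule continuous_imp_integrable_real) simp
  show "integrable ?M f'"
    by (rule integrable_dominated_convergence[OF meas borel_measurable_integrable[OF intq] const lim])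
      (use bound in auto)
  have "(\<lambda>n. LINT x|?M. q n x) \<longlonglongrightarrow> (LINT x|?M. f' x)"
    by (rule integral_dominated_convergence[OF meas borel_measurable_integrable[OF intq] const lim])
      (use bound in auto)
  moreover have "(\<lambda>n. LINT x|?M. q n x) \<longlonglongrightarrow> f b - f a"
    using difference_quotient_integral_tendsto[OF cont \<open>a \<le> b\<close>]
    by (subst lebesgue_integral_eq_integral[OF intq]) (auto simp: q_def[abs_def])
  ultimately show "(LINT x|?M. f' x) = f b - f a"
    using LIMSEQ_unique by blast
qed

subsection \<open>Fourier coefficients: Bessel inequality and uniqueness\<close>

lemma finite_measure_circle: "finite_measure circle_measure"
  by (rule finite_measure_lebesgue_on) simp

lemma continuous_measurable_circle:
  fixes p :: "real \<Rightarrow> 'a::euclidean_space"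
  shows "continuous_on UNIV p \<Longrightarrow> p \<in> borel_measurable circle_measure"
  by (rule continuous_imp_measurable_on_sets_lebesgue) (auto intro: continuous_on_subset)

lemma continuous_integrable_circle:
  fixes p :: "real \<Rightarrow> 'a::euclidean_space"
  shows "continuous_on UNIV p \<Longrightarrow> integrable circle_measure p"
  by (meson continuous_imp_integrable_real continuous_on_subset top_greatest)

lemma bounded_measurable_times_integrable_circle:
  fixes p f :: "real \<Rightarrow> complex"
  assumes "p \<in> borel_measurable circle_measure" "\<And>x. norm (p x) \<le> B" "integrable circle_measure f"
  shows "integrable circle_measure (\<lambda>x. p x * f x)"
proof (rule Bochner_Integration.integrable_bound)
  show "integrable circle_measure (\<lambda>x. B * norm (f x))"
    using assms(3) by simp
  show "AE x in circle_measure. norm (p x * f x) \<le> norm (B * norm (f x))"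
  proof (intro AE_I2)
    fix x
    have "norm (p x) * norm (f x) \<le> B * norm (f x)"
      using assms(2) by (rule mult_right_mono) simp
    then show "norm (p x * f x) \<le> norm (B * norm (f x))"
      by (simp add: norm_mult)
  qed
qed (use assms borel_measurable_integrable in \<open>auto intro: borel_measurable_times\<close>)

lemma L2_imp_integrable_circle:
  fixes f :: "real \<Rightarrow> complex"
  assumes "f \<in> borel_measurable circle_measure" "integrable circle_measure (\<lambda>x. (norm (f x))\<^sup>2)"
  shows "integrable circle_measure f"
proof (rule Bochner_Integration.integrable_bound)
  show "integrable circle_measure (\<lambda>x. 1 + (norm (f x))\<^sup>2)"
    using assms(2) continuous_integrable_circle[of "\<lambda>_. 1 :: real"] by simp
  show "AE x in circle_measure. norm (f x) \<le> norm (1 + (norm (f x))\<^sup>2)"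
  proof (intro AE_I2)
    fix x
    show "norm (f x) \<le> norm (1 + (norm (f x))\<^sup>2)"
      using zero_le_power2[of "norm (f x) - 1"] by (simp add: power2_diff) (use norm_ge_zero[of "f x"] in linarith)
  qed
qed (use assms in auto)

lemma norm_square_triangle: "(norm (a + b :: 'a::real_normed_vector))\<^sup>2 \<le> 2 * (norm a)\<^sup>2 + 2 * (norm b)\<^sup>2"
proof -
  have "(norm (a + b))\<^sup>2 \<le> (norm a + norm b)\<^sup>2"
    by (intro power_mono norm_triangle_ineq) simp
  also have "\<dots> \<le> 2 * (norm a)\<^sup>2 + 2 * (norm b)\<^sup>2"
    using zero_le_power2[of "norm a - norm b"] by (simp add: power2_diff power2_sum)
  finally show ?thesis .
qed

lemma has_vector_derivative_cis_mult:
  "((\<lambda>x. cis (c * x)) has_vector_derivative \<i> * complex_of_real c * cis (c * x)) (at x within S)"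
proof -
  have "((\<lambda>z. exp (\<i> * complex_of_real c * z)) has_field_derivative
      \<i> * complex_of_real c * exp (\<i> * complex_of_real c * of_real x)) (at (of_real x))"
    by (auto intro!: derivative_eq_intros)
  then have "((\<lambda>x. exp (\<i> * complex_of_real c * of_real x)) has_vector_derivative
      \<i> * complex_of_real c * exp (\<i> * complex_of_real c * of_real x)) (at x within S)"
    by (rule has_vector_derivative_real_field)
  then show ?thesis
    by (simp add: cis_conv_exp mult.assoc)
qed

lemma integral_cis_circle:
  "(LINT x|circle_measure. cis (of_int n * x)) = (if n = 0 then 2 * pi else 0)"
proof -
  have int: "integrable circle_measure (\<lambda>x. cis (of_int n * x))"
    by (intro continuous_integrable_circle continuous_intros)
  show ?thesis
  proof (cases "n = 0")
    case True
    then show ?thesis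
      by (simp add: measure_restrict_space scaleR_conv_of_real)
  next
    case False
    have "((\<lambda>x. cis (of_int n * x)) has_integral
        (cis (of_int n * (2 * pi)) / (\<i> * of_int n) - cis (of_int n * 0) / (\<i> * of_int n))) {0..2 * pi}"
    proof (rule fundamental_theorem_of_calculus)
      fix x
      have "((\<lambda>x. cis (of_int n * x) / (\<i> * of_int n)) has_vector_derivative
          (\<i> * of_int n * cis (of_int n * x)) / (\<i> * of_int n)) (at x within {0..2 * pi})"
        using has_vector_derivative_cis_mult[of "of_int n"] by (intro has_vector_derivative_divide) simp
      then show "((\<lambda>x. cis (of_int n * x) / (\<i> * of_int n)) has_vector_derivative cis (of_int n * x))
          (at x within {0..2 * pi})"
        using False by (simp add: scaleR_conv_of_real field_simps)
    qed simp
    moreover have "cis (of_int n * (2 * pi)) = 1"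
      by (metis cis_multiple_2pi mult.assoc mult.commute Ints_of_int)
    ultimately have "integral {0..2 * pi} (\<lambda>x. cis (of_int n * x)) = 0"
      by (simp add: integral_unique)
    then show ?thesis
      using False by (simp add: lebesgue_integral_eq_integral[OF int])
  qed
qed

text \<open>The frequencies form an arbitrary set rather than a symmetric range, so that a
  polynomial can be cut into low and high frequencies.\<close>

definition trig_poly :: "int set \<Rightarrow> (int \<Rightarrow> complex) \<Rightarrow> real \<Rightarrow> complex" where
  "trig_poly F a x = (\<Sum>n\<in>F. a n * cis (of_int n * x))"

lemma continuous_on_trig_poly [continuous_intros]: "continuous_on A (trig_poly F a)"
  unfolding trig_poly_def[abs_def] by (intro continuous_intros)

lemma trig_poly_periodic: "trig_poly F a (x + 2 * pi) = trig_poly F a x"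
proof -
  have "cis (of_int n * (x + 2 * pi)) = cis (of_int n * x)" for n
  proof -
    have "cis (of_int n * (x + 2 * pi)) = cis (of_int n * x) * cis (2 * pi * of_int n)"
      by (simp add: cis_mult algebra_simps)
    then show ?thesis
      by simp
  qed
  then show ?thesis
    by (simp add: trig_poly_def)
qed

lemma integral_trig_poly_norm_square:
  assumes "finite F"
  shows "(LINT x|circle_measure. (norm (trig_poly F a x))\<^sup>2) = 2 * pi * (\<Sum>n\<in>F. (norm (a n))\<^sup>2)"
proof -
  have "complex_of_real ((norm (trig_poly F a x))\<^sup>2)
      = (\<Sum>m\<in>F. \<Sum>n\<in>F. a m * cnj (a n) * cis (of_int (m - n) * x))" for x
  proof -
    have "complex_of_real ((norm (trig_poly F a x))\<^sup>2) = trig_poly F a x * cnj (trig_poly F a x)"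
      by (rule complex_norm_square)
    also have "\<dots> = (\<Sum>m\<in>F. \<Sum>n\<in>F. (a m * cis (of_int m * x)) * (cnj (a n) * cis (- (of_int n * x))))"
      by (simp add: trig_poly_def sum_product cis_cnj)
    also have "\<dots> = (\<Sum>m\<in>F. \<Sum>n\<in>F. a m * cnj (a n) * cis (of_int (m - n) * x))"
      by (intro sum.cong refl) (simp add: cis_mult algebra_simps flip: cis_mult[of "of_int m * x" for m])
    finally show ?thesis .
  qed
  then have "complex_of_real (LINT x|circle_measure. (norm (trig_poly F a x))\<^sup>2)
      = (LINT x|circle_measure. (\<Sum>m\<in>F. \<Sum>n\<in>F. a m * cnj (a n) * cis (of_int (m - n) * x)))"
    by (simp only: flip: integral_complex_of_real)
  also have "\<dots> = (\<Sum>m\<in>F. \<Sum>n\<in>F. a m * cnj (a n) * (LINT x|circle_measure. cis (of_int (m - n) * x)))"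
  proof -
    have *: "integrable circle_measure (\<lambda>x. a m * cnj (a n) * cis (of_int (m - n) * x))" for m n
      by (intro continuous_integrable_circle continuous_intros)
    show ?thesis
      using * by (simp add: Bochner_Integration.integral_sum Bochner_Integration.integrable_sum del: of_int_diff)
  qed
  also have "\<dots> = (\<Sum>m\<in>F. 2 * pi * (a m * cnj (a m)))"
  proof (intro sum.cong refl)
    fix m assume "m \<in> F"
    have "(\<Sum>n\<in>F. a m * cnj (a n) * (LINT x|circle_measure. cis (of_int (m - n) * x)))
        = (\<Sum>n\<in>F. if n = m then 2 * pi * (a m * cnj (a m)) else 0)"
      by (intro sum.cong refl) (simp add: integral_cis_circle del: of_int_diff)
    then show "(\<Sum>n\<in>F. a m * cnj (a n) * (LINT x|circle_measure. cis (of_int (m - n) * x)))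
        = 2 * pi * (a m * cnj (a m))"
      using \<open>m \<in> F\<close> assms by simp
  qed
  also have "\<dots> = complex_of_real (2 * pi * (\<Sum>n\<in>F. (norm (a n))\<^sup>2))"
    by (simp add: sum_distrib_left complex_norm_square del: of_real_power)
  finally show ?thesis
    using of_real_eq_iff by blast
qed

text \<open>The integral of |f - p|^2 is nonnegative, where p has the Fourier coefficients of
  \<open>f\<close> on \<open>F\<close>. The integral of f times the conjugate of p and that of |p|^2
  both equal 2 pi times \<open>S\<close>.\<close>

lemma fourier_coeff_bessel:
  assumes f: "f \<in> borel_measurable circle_measure" "integrable circle_measure (\<lambda>x. (norm (f x))\<^sup>2)"
    and "finite F"
  shows "2 * pi * (\<Sum>n\<in>F. (norm (fourier_coeff f n))\<^sup>2) \<le> (LINT x|circle_measure. (norm (f x))\<^sup>2)"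
proof -
  define c where "c = fourier_coeff f"
  define S where "S = (\<Sum>n\<in>F. (norm (c n))\<^sup>2)"
  have intf: "integrable circle_measure f"
    using f by (rule L2_imp_integrable_circle)
  have int: "integrable circle_measure (\<lambda>x. cnj (c n) * (f x * cis (- (of_int n * x))))" for n
  proof -
    have "integrable circle_measure (\<lambda>x. cis (- of_int n * x) * f x)"
      using intf by (intro bounded_measurable_times_integrable_circle[where B = 1]
          continuous_measurable_circle continuous_intros) auto
    then show ?thesis
      by (simp add: mult.commute)
  qed
  have cross: "(LINT x|circle_measure. f x * cnj (trig_poly F c x)) = complex_of_real (2 * pi * S)"
  proof -
    have "(LINT x|circle_measure. f x * cnj (trig_poly F c x))
        = (LINT x|circle_measure. (\<Sum>n\<in>F. cnj (c n) * (f x * cis (- (of_int n * x)))))"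
      by (simp add: trig_poly_def sum_distrib_left cis_cnj mult_ac)
    also have "\<dots> = (\<Sum>n\<in>F. cnj (c n) * (LINT x|circle_measure. f x * cis (- (of_int n * x))))"
      using int by (subst Bochner_Integration.integral_sum) auto
    also have "\<dots> = (\<Sum>n\<in>F. cnj (c n) * (2 * pi * c n))"
      by (intro sum.cong refl) (simp add: c_def fourier_coeff_def scaleR_conv_of_real)
    also have "\<dots> = complex_of_real (2 * pi * S)"
      by (simp add: S_def sum_distrib_left complex_norm_square mult_ac del: of_real_power)
    finally show ?thesis .
  qed
  have intc: "integrable circle_measure (\<lambda>x. f x * cnj (trig_poly F c x))"
  proof -
    have "integrable circle_measure (\<lambda>x. \<Sum>n\<in>F. cnj (c n) * (f x * cis (- (of_int n * x))))"
      using int by (rule Bochner_Integration.integrable_sum)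
    then show ?thesis
      by (simp add: trig_poly_def sum_distrib_left cis_cnj mult_ac)
  qed
  have intp: "integrable circle_measure (\<lambda>x. (norm (trig_poly F c x))\<^sup>2)"
    by (intro continuous_integrable_circle continuous_intros)
  have "0 \<le> (LINT x|circle_measure. (norm (f x - trig_poly F c x))\<^sup>2)"
    by simp
  also have "(\<lambda>x. (norm (f x - trig_poly F c x))\<^sup>2)
      = (\<lambda>x. (norm (f x))\<^sup>2 - 2 * Re (f x * cnj (trig_poly F c x)) + (norm (trig_poly F c x))\<^sup>2)"
    by (intro ext) (simp only: cmod_power2, simp add: power2_eq_square algebra_simps)
  also have "(LINT x|circle_measure. (norm (f x))\<^sup>2 - 2 * Re (f x * cnj (trig_poly F c x)) + (norm (trig_poly F c x))\<^sup>2)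
      = (LINT x|circle_measure. (norm (f x))\<^sup>2) - 2 * (LINT x|circle_measure. Re (f x * cnj (trig_poly F c x)))
        + (LINT x|circle_measure. (norm (trig_poly F c x))\<^sup>2)"
    using f(2) integrable_Re[OF intc] intp by (simp del: complex_cnj_mult times_complex.sel)
  also have "\<dots> = (LINT x|circle_measure. (norm (f x))\<^sup>2) - 2 * Re (LINT x|circle_measure. f x * cnj (trig_poly F c x))
        + (LINT x|circle_measure. (norm (trig_poly F c x))\<^sup>2)"
    using integral_Re[OF intc] by simp
  also have "\<dots> = (LINT x|circle_measure. (norm (f x))\<^sup>2) - 2 * pi * S"
    using \<open>finite F\<close> by (simp add: cross integral_trig_poly_norm_square S_def)
  finally show ?thesis
    by (simp add: S_def c_def)
qed

section \<open>Uniqueness of Fourier coefficients\<close>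

text \<open>On the circle a real linear function is a combination of \<open>cis x\<close> and
  \<open>cis (- x)\<close>, so multiplying by it shifts frequencies by one and keeps all Fourier
  integrals zero. Leaving \<open>h\<close> arbitrary lets the product case apply the hypothesis for
  \<open>p\<close> to the function already multiplied by \<open>q\<close>.\<close>

lemma zero_fourier_coeffs_polynomial:
  fixes h :: "real \<Rightarrow> complex"
  assumes "real_polynomial_function p"
    and "integrable circle_measure h" and "\<And>n::int. (LINT x|circle_measure. h x * cis (of_int n * x)) = 0"
  shows "integrable circle_measure (\<lambda>x. p (cis x) * h x) \<and>
    (\<forall>n::int. (LINT x|circle_measure. (p (cis x) * h x) * cis (of_int n * x)) = 0)"
  using assms
proof (induction arbitrary: h rule: real_polynomial_function.induct)
  case (linear p)
  have int: "integrable circle_measure (\<lambda>x. h x * cis (of_int n * x))" for n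
  proof -
    have "integrable circle_measure (\<lambda>x. cis (of_int n * x) * h x)"
      using linear.prems(1) by (intro bounded_measurable_times_integrable_circle[where B = 1]
          continuous_measurable_circle continuous_intros) auto
    then show ?thesis
      by (simp add: mult.commute)
  qed
  \<comment> \<open>Euler's formulas for cosine and sine, inserted into p(cis x) = cos x p(1) + sin
    x p(\<i>), give these two coefficients.\<close>
  define A where "A = (p 1 - \<i> * p \<i>) / 2"
  define B where "B = (p 1 + \<i> * p \<i>) / 2"
  have p: "complex_of_real (p (cis x)) = A * cis (of_int 1 * x) + B * cis (of_int (-1) * x)" for x
  proof -
    have "cis x = cos x *\<^sub>R 1 + sin x *\<^sub>R \<i>"
      by (simp add: complex_eq_iff)
    then have "p (cis x) = cos x * p 1 + sin x * p \<i>"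
      using linear.hyps by (simp add: linear_add linear_scale bounded_linear.linear)
    then show ?thesis
      by (simp add: A_def B_def complex_eq_iff field_simps)
  qed
  have eq: "(p (cis x) * h x) * cis (of_int n * x)
      = A * (h x * cis (of_int (n + 1) * x)) + B * (h x * cis (of_int (n - 1) * x))" for n x
  proof -
    have "cis (of_int (n + 1) * x) = cis (of_int n * x) * cis (of_int 1 * x)"
      "cis (of_int (n - 1) * x) = cis (of_int n * x) * cis (of_int (-1) * x)"
      by (simp_all only: cis_mult) (simp_all add: algebra_simps)
    then show ?thesis
      by (simp only: p) (simp add: algebra_simps)
  qed
  have "integrable circle_measure (\<lambda>x. (p (cis x) * h x) * cis (of_int n * x))" for n
    unfolding eq using int[of "n + 1"] int[of "n - 1"] by auto
  from this[of 0] have "integrable circle_measure (\<lambda>x. p (cis x) * h x)"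
    by simp
  moreover have "(LINT x|circle_measure. (p (cis x) * h x) * cis (of_int n * x)) = 0" for n
    unfolding eq using int[of "n + 1"] int[of "n - 1"] linear.prems(2)[of "n + 1"] linear.prems(2)[of "n - 1"]
    by (simp del: of_int_add of_int_diff)
  ultimately show ?case
    by blast
next
  case (const c)
  then show ?case
    by (auto simp: mult.assoc)
next
  case (add p q)
  have int: "integrable circle_measure (\<lambda>x. (p (cis x) * h x) * cis (of_int n * x))"
    "integrable circle_measure (\<lambda>x. (q (cis x) * h x) * cis (of_int n * x))" for n
  proof -
    have "integrable circle_measure (\<lambda>x. cis (of_int n * x) * (p (cis x) * h x))"
      "integrable circle_measure (\<lambda>x. cis (of_int n * x) * (q (cis x) * h x))"
      using add.IH[OF add.prems] by (auto intro!: bounded_measurable_times_integrable_circle[where B = 1]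
          continuous_measurable_circle continuous_intros)
    then show "integrable circle_measure (\<lambda>x. (p (cis x) * h x) * cis (of_int n * x))"
      "integrable circle_measure (\<lambda>x. (q (cis x) * h x) * cis (of_int n * x))"
      by (simp_all add: mult.commute)
  qed
  show ?case
    using add.IH[OF add.prems] int by (simp add: distrib_right)
next
  case (mult p q)
  then have "integrable circle_measure (\<lambda>x. p (cis x) * (q (cis x) * h x)) \<and>
    (\<forall>n::int. (LINT x|circle_measure. (p (cis x) * (q (cis x) * h x)) * cis (of_int n * x)) = 0)"
    by (intro mult.IH(1)) auto
  then show ?case
    by (simp add: mult.assoc)
qed

text \<open>Stone-Weierstrass on the unit circle: a polynomial within \<open>e\<close> of
  \<open>f\<close> integrates to 0 against \<open>h\<close>, so the integral in question is at most
  \<open>e\<close> times the L1 norm of \<open>h\<close>.\<close>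

lemma zero_fourier_coeffs_continuous:
  fixes h :: "real \<Rightarrow> complex" and f :: "complex \<Rightarrow> real"
  assumes h: "integrable circle_measure h" and zero: "\<And>n. fourier_coeff h n = 0"
    and f: "continuous_on (sphere 0 1) f"
  shows "(LINT x|circle_measure. f (cis x) * h x) = 0"
proof -
  have zero': "(LINT x|circle_measure. h x * cis (of_int n * x)) = 0" for n
    using zero[of "-n"] by (simp add: fourier_coeff_def)
  have intf: "integrable circle_measure (\<lambda>x. complex_of_real (f (cis x)) * h x)"
  proof -
    have "bounded (f ` sphere 0 1)"
      using f by (intro compact_imp_bounded compact_continuous_image) auto
    then obtain B where "\<forall>z\<in>sphere 0 1. norm (f z) \<le> B"
      unfolding bounded_iff by auto
    then have "norm (complex_of_real (f (cis x))) \<le> B" for x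
      by simp
    moreover have "continuous_on UNIV (\<lambda>x. f (cis x))"
      by (intro continuous_on_compose2[OF f] continuous_intros) auto
    ultimately show ?thesis
      using h by (intro bounded_measurable_times_integrable_circle[where B = B]
          continuous_measurable_circle continuous_intros)
  qed
  define K where "K = (LINT x|circle_measure. norm (h x))"
  have "K \<ge> 0"
    by (simp add: K_def)
  have "norm (LINT x|circle_measure. f (cis x) * h x) \<le> e * K" if "e > 0" for e
  proof -
    obtain p where p: "real_polynomial_function p" and fp: "\<And>z. z \<in> sphere 0 1 \<Longrightarrow> \<bar>f z - p z\<bar> < e"
      using Stone_Weierstrass_real_polynomial_function[OF _ f \<open>e > 0\<close>] by auto
    have ip: "integrable circle_measure (\<lambda>x. p (cis x) * h x)"
      and zp: "(LINT x|circle_measure. p (cis x) * h x) = 0"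
      using zero_fourier_coeffs_polynomial[OF p h zero'] by (auto dest: spec[of _ 0])
    have "(LINT x|circle_measure. f (cis x) * h x) = (LINT x|circle_measure. f (cis x) * h x - p (cis x) * h x)"
      using intf ip zp by simp
    also have "norm \<dots> \<le> (LINT x|circle_measure. norm (f (cis x) * h x - p (cis x) * h x))"
      by (rule integral_norm_bound)
    also have "\<dots> \<le> (LINT x|circle_measure. e * norm (h x))"
    proof (rule integral_mono)
      show "integrable circle_measure (\<lambda>x. norm (f (cis x) * h x - p (cis x) * h x))"
        using intf ip by simp
      fix x
      have "norm (f (cis x) * h x - p (cis x) * h x) = \<bar>f (cis x) - p (cis x)\<bar> * norm (h x)"
        by (metis left_diff_distrib norm_mult norm_of_real of_real_diff)
      also have "\<dots> \<le> e * norm (h x)"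
        using fp[of "cis x"] by (intro mult_right_mono) auto
      finally show "norm (f (cis x) * h x - p (cis x) * h x) \<le> e * norm (h x)" .
    qed (use h in simp)
    also have "\<dots> = e * K"
      by (simp add: K_def)
    finally show ?thesis .
  qed
  then have *: "norm (LINT x|circle_measure. f (cis x) * h x) \<le> e * K" if "e > 0" for e
    using that by blast
  have "norm (LINT x|circle_measure. f (cis x) * h x) \<le> 0 + e" if "e > 0" for e
  proof -
    \<comment> \<open>Dividing by K + 1 rather than by \<open>K\<close> covers the case where the L1
      norm of \<open>h\<close> is 0.\<close>
    have "e / (K + 1) * K \<le> e"
      using \<open>K \<ge> 0\<close> \<open>e > 0\<close> by (simp add: field_simps)
    then show ?thesis
      using *[of "e / (K + 1)"] \<open>K \<ge> 0\<close> \<open>e > 0\<close> by simp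
  qed
  then have "norm (LINT x|circle_measure. f (cis x) * h x) \<le> 0"
    by (rule field_le_epsilon)
  then show ?thesis
    by simp
qed

text \<open>The indicator of an arc is a pointwise limit of continuous functions on the circle. The
  bound b < 2 pi is strict because \<open>cis\<close> identifies 0 with 2 pi: an interval ending
  there would bring the point 0 into the arc.\<close>

lemma zero_fourier_coeffs_interval:
  fixes h :: "real \<Rightarrow> complex"
  assumes h: "integrable circle_measure h" and zero: "\<And>n. fourier_coeff h n = 0"
    and ab: "0 \<le> a" "a \<le> b" "b < 2 * pi"
  shows "(LINT x|circle_measure. (if x \<in> {a..b} then h x else 0)) = 0"
proof -
  define A where "A = cis ` {a..b}"
  have "compact A"
    unfolding A_def by (intro compact_continuous_image continuous_intros compact_Icc)
  then have "closed A" "A \<noteq> {}"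
    using ab by (auto simp: A_def compact_imp_closed)
  \<comment> \<open>Equal to 1 on the arc and falling to 0 within distance 1 / k of it.\<close>
  define p where "p k z = max 0 (1 - real k * infdist z A)" for k z
  have contp: "continuous_on S (p k)" for k S
    unfolding p_def by (intro continuous_intros)
  have p01: "0 \<le> p k z" "p k z \<le> 1" for k z
    by (auto simp: p_def infdist_nonneg)
  have cisA: "cis x \<in> A \<longleftrightarrow> x \<in> {a..b}" if "0 \<le> x" "x < 2 * pi" for x
  proof
    assume "cis x \<in> A"
    then obtain y where y: "y \<in> {a..b}" "cis x = cis y"
      by (auto simp: A_def)
    then have "x = y"
      using that ab by (metis Arg2pi_unique atLeastAtMost_iff cis_conv_exp mult.left_neutral of_real_1
        order_le_less_trans order_trans zero_less_one)
    then show "x \<in> {a..b}"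
      using y by simp
  qed (auto simp: A_def)
  have lim: "(\<lambda>k. complex_of_real (p k (cis x)) * h x) \<longlonglongrightarrow> (if x \<in> {a..b} then h x else 0)"
    if "0 \<le> x" "x < 2 * pi" for x
  proof (cases "x \<in> {a..b}")
    case True
    then have "p k (cis x) = 1" for k
      using cisA[OF that] by (simp add: p_def)
    then show ?thesis
      using True by simp
  next
    case False
    then have "infdist (cis x) A > 0"
      using cisA[OF that] \<open>closed A\<close> \<open>A \<noteq> {}\<close> by (metis in_closed_iff_infdist_zero infdist_nonneg less_eq_real_def)
    then obtain K where K: "real K * infdist (cis x) A > 1"
      using reals_Archimedean3 by blast
    have "p k (cis x) = 0" if "k \<ge> K" for k
    proof -
      have "real K * infdist (cis x) A \<le> real k * infdist (cis x) A"
        using that by (intro mult_right_mono infdist_nonneg) simp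
      then show ?thesis
        using K by (simp add: p_def)
    qed
    then have "\<forall>\<^sub>F k in sequentially. complex_of_real (p k (cis x)) * h x = (if x \<in> {a..b} then h x else 0)"
      unfolding eventually_sequentially using False by (intro exI[of _ K]) auto
    then show ?thesis
      by (rule tendsto_eventually)
  qed
  have "(\<lambda>k. LINT x|circle_measure. complex_of_real (p k (cis x)) * h x)
      \<longlonglongrightarrow> (LINT x|circle_measure. (if x \<in> {a..b} then h x else 0))"
  proof (rule integral_dominated_convergence)
    show "integrable circle_measure (\<lambda>x. norm (h x))"
      using h by simp
    have "integrable circle_measure (\<lambda>x. indicator {a..b} x *\<^sub>R h x)"
      using h by (intro integrable_mult_indicator) (use ab in \<open>auto simp: sets_restrict_space_iff\<close>)
    then show "(\<lambda>x. if x \<in> {a..b} then h x else 0) \<in> borel_measurable circle_measure"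
      by (simp add: indicator_scaleR_eq_if borel_measurable_integrable)
    show "(\<lambda>x. complex_of_real (p k (cis x)) * h x) \<in> borel_measurable circle_measure" for k
      by (intro borel_measurable_times[OF continuous_measurable_circle borel_measurable_integrable[OF h]]
          continuous_intros continuous_on_compose2[OF contp]) auto
    show "AE x in circle_measure. (\<lambda>k. complex_of_real (p k (cis x)) * h x) \<longlonglongrightarrow> (if x \<in> {a..b} then h x else 0)"
    proof -
      \<comment> \<open>At 2 pi the functions see the value belonging to 0, which may lie on the arc
        although 2 pi is outside [a, b]; this single point is discarded.\<close>
      have "AE x in lebesgue. x \<noteq> 2 * pi"
        using AE_not_in[of "{2 * pi}" lebesgue] by simp
      then have "AE x in lebesgue. x \<in> {0..2 * pi} \<longrightarrow>
          (\<lambda>k. complex_of_real (p k (cis x)) * h x) \<longlonglongrightarrow> (if x \<in> {a..b} then h x else 0)"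
      proof eventually_elim
        case (elim x)
        then show ?case
          using lim[of x] by force
      qed
      then show ?thesis
        by (subst AE_restrict_space_iff) auto
    qed
    show "AE x in circle_measure. norm (complex_of_real (p k (cis x)) * h x) \<le> norm (h x)" for k
      using p01 by (auto simp: norm_mult intro!: mult_left_le_one_le)
  qed
  moreover have "(LINT x|circle_measure. complex_of_real (p k (cis x)) * h x) = 0" for k
    using zero_fourier_coeffs_continuous[OF h zero contp] by simp
  ultimately show ?thesis
    by (simp add: LIMSEQ_const_iff)
qed

text \<open>Integrals over all subintervals vanish, so Lebesgue differentiation forces the function
  to be 0 at almost every point. The extension \<open>k\<close> by 0 makes differentiation on the
  line applicable.\<close>

lemma fourier_coeff_unique:
  fixes h :: "real \<Rightarrow> complex"
  assumes h: "integrable circle_measure h" and zero: "\<And>n. fourier_coeff h n = 0"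
  shows "AE x in circle_measure. h x = 0"
proof -
  define k where "k x = (if x \<in> {0..2 * pi} then h x else 0)" for x
  have "integrable lebesgue (\<lambda>x. indicator {0..2 * pi} x *\<^sub>R h x)"
    using h by (subst (asm) integrable_restrict_space) auto
  then have "integrable lebesgue k"
    by (simp add: k_def[abs_def] indicator_scaleR_eq_if)
  then have "k integrable_on UNIV"
    by (rule integrable_on_lebesgue)
  then have "k integrable_on cbox a b" for a b
    by (rule integrable_on_subcbox) simp
  then obtain N where "negligible N" and N: "\<And>x e. \<lbrakk>x \<notin> N; 0 < e\<rbrakk> \<Longrightarrow>
      \<exists>d>0. \<forall>h. 0 < h \<and> h < d \<longrightarrow> norm (integral (cbox x (x + h *\<^sub>R One)) k /\<^sub>R h ^ DIM(real) - k x) < e"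
    using integrable_ccontinuous_explicit[of k] by blast
  have int0: "integral {a..b} k = 0" if ab: "0 \<le> a" "a \<le> b" "b < 2 * pi" for a b
  proof -
    have inth: "integrable (lebesgue_on {a..b}) h"
    proof -
      have "integrable lebesgue (\<lambda>x. indicator {a..b} x *\<^sub>R (indicator {0..2 * pi} x *\<^sub>R h x))"
        using \<open>integrable lebesgue (\<lambda>x. indicator {0..2 * pi} x *\<^sub>R h x)\<close>
        by (rule integrable_mult_indicator[rotated]) simp
      moreover have "indicator {a..b} x *\<^sub>R (indicator {0..2 * pi} x *\<^sub>R h x) = indicator {a..b} x *\<^sub>R h x" for x
        using ab by (auto simp: indicator_def)
      ultimately have "integrable lebesgue (\<lambda>x. indicator {a..b} x *\<^sub>R h x)"
        by (simp only:)
      then show ?thesis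
        by (subst integrable_restrict_space) auto
    qed
    have "{a..b} \<inter> {0..2 * pi} = {a..b}"
      using ab by auto
    then have "(LINT x|lebesgue_on {a..b}. h x) = 0"
      using zero_fourier_coeffs_interval[OF h zero ab] Lebesgue_Measure.integral_restrict_Int[of "{a..b}" "{0..2 * pi}" h]
      by (simp del: Int_atLeastAtMost)
    then have "integral {a..b} h = 0"
      using inth by (simp add: lebesgue_integral_eq_integral)
    moreover have "integral {a..b} k = integral {a..b} h"
      using ab by (intro Henstock_Kurzweil_Integration.integral_cong) (auto simp: k_def)
    ultimately show ?thesis
      by simp
  qed
  have k0: "k x = 0" if "x \<notin> N" "0 \<le> x" "x < 2 * pi" for x
  proof -
    have "norm (k x) \<le> 0 + e" if "e > 0" for e
    proof -
      obtain d where "d > 0" and d: "\<And>s. 0 < s \<and> s < d \<Longrightarrow>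
          norm (integral (cbox x (x + s *\<^sub>R One)) k /\<^sub>R s ^ DIM(real) - k x) < e"
        using N[OF \<open>x \<notin> N\<close> \<open>e > 0\<close>] by blast
      \<comment> \<open>Halving the minimum keeps \<open>s\<close> strictly below \<open>d\<close>
        and x + s strictly below 2 pi.\<close>
      define s where "s = min d (2 * pi - x) / 2"
      have "0 < s" "s < d" "x + s < 2 * pi"
        using \<open>d > 0\<close> \<open>x < 2 * pi\<close> by (auto simp: s_def min_def field_simps)
      then show ?thesis
        using d[of s] int0[of x "x + s"] \<open>0 \<le> x\<close> by simp
    qed
    then have "norm (k x) \<le> 0"
      by (rule field_le_epsilon)
    then show ?thesis
      by simp
  qed
  have "insert (2 * pi) N \<in> null_sets lebesgue"
    using \<open>negligible N\<close> by (simp flip: negligible_iff_null_sets)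
  then have "AE x in lebesgue. x \<notin> insert (2 * pi) N"
    by (rule AE_not_in)
  then have "AE x in lebesgue. x \<in> {0..2 * pi} \<longrightarrow> h x = 0"
  proof eventually_elim
    case (elim x)
    then show ?case
      using k0[of x] by (auto simp: k_def)
  qed
  then show ?thesis
    by (subst AE_restrict_space_iff) auto
qed

subsection \<open>Estimates for trigonometric polynomials\<close>

text \<open>\<open>real_of_ereal\<close> is faithful only on finite values: \<open>B\<close>
  excludes \<infinity>, and the positive measure of the circle keeps the essential supremum of a
  nonnegative function nonnegative.\<close>

lemma Linf_norm_bound:
  assumes meas: "f \<in> borel_measurable circle_measure" and bound: "AE x in circle_measure. \<bar>f x\<bar> \<le> B"
  shows "0 \<le> Linf_norm f" "AE x in circle_measure. \<bar>f x\<bar> \<le> Linf_norm f"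
proof -
  define E where "E = esssup circle_measure (\<lambda>x. ereal \<bar>f x\<bar>)"
  have meas': "(\<lambda>x. ereal \<bar>f x\<bar>) \<in> borel_measurable circle_measure"
    using meas by simp
  have "E \<le> ereal B"
    unfolding E_def using bound by (intro esssup_I[OF meas']) simp
  have "emeasure circle_measure (space circle_measure) \<noteq> 0"
    by (simp add: emeasure_restrict_space)
  then have "esssup circle_measure (\<lambda>x. 0 :: ereal) = 0"
    by (rule esssup_const)
  then have "0 \<le> E"
    unfolding E_def using esssup_mono[of "\<lambda>x. 0 :: ereal" circle_measure "\<lambda>x. ereal \<bar>f x\<bar>"] by simp
  with \<open>E \<le> ereal B\<close> have E: "E = ereal (Linf_norm f)"
    by (cases E) (auto simp: Linf_norm_def E_def)
  show "0 \<le> Linf_norm f"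
    using \<open>0 \<le> E\<close> by (simp add: E)
  have "AE x in circle_measure. ereal \<bar>f x\<bar> \<le> E"
    unfolding E_def by (rule esssup_AE)
  then show "AE x in circle_measure. \<bar>f x\<bar> \<le> Linf_norm f"
    by (simp add: E)
qed

text \<open>Both properties pass to the limit from the difference quotients. They are the two
  premises of \<open>Linf_norm_bound\<close> for the derivative.\<close>

lemma lipschitz_AE_deriv:
  fixes f :: "real \<Rightarrow> real"
  assumes lip: "L-lipschitz_on UNIV f"
    and der: "AE x in lebesgue_on {a..b}. (f has_real_derivative f' x) (at x)"
  shows "f' \<in> borel_measurable (lebesgue_on {a..b})" "AE x in lebesgue_on {a..b}. \<bar>f' x\<bar> \<le> L"
proof -
  let ?q = "\<lambda>n x. real (Suc n) *\<^sub>R (f (x + 1 / real (Suc n)) - f x)"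
  have lim: "AE x in lebesgue_on {a..b}. (\<lambda>n. ?q n x) \<longlonglongrightarrow> f' x"
    using der
    by eventually_elim (rule LIMSEQ_derivative[OF has_real_derivative_iff_has_vector_derivative[THEN iffD1]])
  have cont: "continuous_on UNIV f"
    using lip by (rule lipschitz_on_continuous_on)
  show "f' \<in> borel_measurable (lebesgue_on {a..b})"
  proof (rule borel_measurable_AE_limit_lebesgue_on[OF _ _ lim])
    show "?q n \<in> borel_measurable (lebesgue_on {a..b})" for n
      by (intro continuous_imp_measurable_on_sets_lebesgue continuous_intros continuous_on_compose2[OF cont]) auto
  qed simp
  have bound: "\<bar>?q n x\<bar> \<le> L" for n x
  proof -
    have "\<bar>f (x + 1 / real (Suc n)) - f x\<bar> \<le> L * (1 / real (Suc n))"
      using lipschitz_on_normD[OF lip, of "x + 1 / real (Suc n)" x] by simp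
    then have "real (Suc n) * \<bar>f (x + 1 / real (Suc n)) - f x\<bar> \<le> real (Suc n) * (L * (1 / real (Suc n)))"
      by (rule mult_left_mono) simp
    then show ?thesis
      by (simp add: abs_mult del: of_nat_Suc)
  qed
  show "AE x in lebesgue_on {a..b}. \<bar>f' x\<bar> \<le> L"
    using lim
  proof eventually_elim
    case (elim x)
    then have "(\<lambda>n. \<bar>?q n x\<bar>) \<longlonglongrightarrow> \<bar>f' x\<bar>"
      by (rule tendsto_rabs)
    then show ?case
      by (rule LIMSEQ_le_const2) (use bound in blast)
  qed
qed

lemma lipschitz_on_mult_bounded:
  fixes f g :: "'a::metric_space \<Rightarrow> 'b::real_normed_algebra"
  assumes f: "A-lipschitz_on UNIV f" "\<And>x. norm (f x) \<le> P" and g: "B-lipschitz_on UNIV g" "\<And>x. norm (g x) \<le> Q"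
  shows "(P * B + A * Q)-lipschitz_on UNIV (\<lambda>x. f x * g x)"
proof (rule lipschitz_onI)
  have nn: "0 \<le> A" "0 \<le> B" "0 \<le> P" "0 \<le> Q"
    using f g lipschitz_on_nonneg norm_ge_zero order_trans by blast+
  then show "0 \<le> P * B + A * Q"
    by simp
  fix x y :: 'a
  have "f x * g x - f y * g y = f x * (g x - g y) + (f x - f y) * g y"
    by (simp add: algebra_simps)
  then have "norm (f x * g x - f y * g y) \<le> norm (f x) * norm (g x - g y) + norm (f x - f y) * norm (g y)"
    by (metis add_mono norm_mult_ineq norm_triangle_le)
  also have "\<dots> \<le> P * (B * dist x y) + (A * dist x y) * Q"
    using f g nn lipschitz_onD[OF f(1), of x y] lipschitz_onD[OF g(1), of x y]
    by (intro add_mono mult_mono) (auto simp: dist_norm)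
  finally show "dist (f x * g x) (f y * g y) \<le> (P * B + A * Q) * dist x y"
    by (simp add: dist_norm algebra_simps)
qed

lemma vector_derivative_bounded_imp_lipschitz:
  fixes f :: "real \<Rightarrow> 'a::real_normed_vector"
  assumes der: "\<And>x. (f has_vector_derivative f' x) (at x)" and bound: "\<And>x. norm (f' x) \<le> B"
  shows "B-lipschitz_on UNIV f"
proof (rule bounded_derivative_imp_lipschitz)
  show "(f has_derivative (\<lambda>h. h *\<^sub>R f' x)) (at x within UNIV)" for x
    using der[of x] by (simp add: has_vector_derivative_def)
  show "onorm (\<lambda>h. h *\<^sub>R f' x) \<le> B" for x
    using bound[of x] by (simp add: onorm_scaleR_left onorm_id bounded_linear_ident)
  show "0 \<le> B"
    using bound[of 0] norm_ge_zero order_trans by blast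
qed auto

section \<open>Derivatives and mean square increments of trigonometric polynomials\<close>

text \<open>Acting on coefficients keeps derivatives of every order inside \<open>trig_poly\<close>;
  second derivatives arise by applying it twice.\<close>

definition trig_deriv :: "(int \<Rightarrow> complex) \<Rightarrow> int \<Rightarrow> complex" where
  "trig_deriv a n = \<i> * of_int n * a n"

lemma trig_poly_has_derivative:
  "(trig_poly F a has_vector_derivative trig_poly F (trig_deriv a) x) (at x)"
proof -
  have "((\<lambda>x. \<Sum>n\<in>F. a n * cis (of_int n * x)) has_vector_derivative
      (\<Sum>n\<in>F. a n * (\<i> * complex_of_real (of_int n) * cis (of_int n * x)))) (at x)"
    by (intro has_vector_derivative_sum has_vector_derivative_mult_right has_vector_derivative_cis_mult)
  then show ?thesis
    by (simp add: trig_poly_def[abs_def] trig_deriv_def mult_ac)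
qed

lemma norm_trig_poly_le: "norm (trig_poly F a x) \<le> (\<Sum>n\<in>F. norm (a n))"
  unfolding trig_poly_def by (rule order_trans[OF norm_sum]) (simp add: norm_mult)

lemma trig_poly_lipschitz: "(\<Sum>n\<in>F. norm (trig_deriv a n))-lipschitz_on UNIV (trig_poly F a)"
  using trig_poly_has_derivative norm_trig_poly_le by (rule vector_derivative_bounded_imp_lipschitz)

lemma cis_lipschitz: "\<bar>c\<bar>-lipschitz_on UNIV (\<lambda>x. cis (c * x))"
  by (rule vector_derivative_bounded_imp_lipschitz[OF has_vector_derivative_cis_mult]) (simp add: norm_mult)

lemma integral_cauchy_schwarz:
  fixes f :: "real \<Rightarrow> 'a::euclidean_space"
  assumes "continuous_on {a..b} f" "a \<le> b"
  shows "(norm (integral {a..b} f))\<^sup>2 \<le> (b - a) * integral {a..b} (\<lambda>x. (norm (f x))\<^sup>2)"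
proof (cases "a = b")
  case False
  with \<open>a \<le> b\<close> have "a < b"
    by simp
  define I where "I = integral {a..b} (\<lambda>x. norm (f x))"
  define J where "J = integral {a..b} (\<lambda>x. (norm (f x))\<^sup>2)"
  have int: "f integrable_on {a..b}" "(\<lambda>x. norm (f x)) integrable_on {a..b}" "(\<lambda>x. (norm (f x))\<^sup>2) integrable_on {a..b}"
    using assms by (intro integrable_continuous_real continuous_intros; simp)+
  have le: "norm (integral {a..b} f) \<le> I"
    unfolding I_def using int by (intro Henstock_Kurzweil_Integration.integral_norm_bound_integral) auto
  \<comment> \<open>The integrand is the square of (b - a) |f| - I, so nonnegativity of this
    integral is the Cauchy-Schwarz inequality up to the factor b - a.\<close>
  have "((\<lambda>x. (b - a)\<^sup>2 * (norm (f x))\<^sup>2 - 2 * (b - a) * I * norm (f x) + I\<^sup>2) has_integral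
      ((b - a)\<^sup>2 * J - 2 * (b - a) * I * I + (b - a) * I\<^sup>2)) {a..b}"
    unfolding J_def using int has_integral_const_real[of "I\<^sup>2" a b] \<open>a < b\<close> has_integral_integral[THEN iffD1, OF int(2), folded I_def]
    by (intro has_integral_add has_integral_diff has_integral_mult_right integrable_integral) (auto simp: I_def)
  moreover have "0 \<le> (b - a)\<^sup>2 * (norm (f x))\<^sup>2 - 2 * (b - a) * I * norm (f x) + I\<^sup>2" for x
  proof -
    have "((b - a) * norm (f x) - I)\<^sup>2 = (b - a)\<^sup>2 * (norm (f x))\<^sup>2 - 2 * (b - a) * I * norm (f x) + I\<^sup>2"
      by (simp add: power2_eq_square algebra_simps)
    then show ?thesis
      using zero_le_power2[of "(b - a) * norm (f x) - I"] by simp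
  qed
  ultimately have "0 \<le> (b - a)\<^sup>2 * J - 2 * (b - a) * I * I + (b - a) * I\<^sup>2"
    by (rule has_integral_nonneg)
  also have "\<dots> = (b - a) * ((b - a) * J - I\<^sup>2)"
    using \<open>a < b\<close> by (simp add: power2_eq_square algebra_simps)
  finally have "I\<^sup>2 \<le> (b - a) * J"
    using \<open>a < b\<close> by (simp add: zero_le_mult_iff)
  moreover have "(norm (integral {a..b} f))\<^sup>2 \<le> I\<^sup>2"
    using le by (intro power_mono) auto
  ultimately show ?thesis
    unfolding J_def by linarith
qed simp

text \<open>If |y - x| \<le> t, then |v(y) - v(x)|^2 is at most t times the integral of |v'|^2 over
  [x - t, x + t]. This majorant depends on \<open>x\<close> alone. Integrating it in
  \<open>x\<close> and exchanging the integrals gives 2 t^2 times the squared L2 norm of v'.\<close>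

lemma displacement_bound:
  assumes "finite F" "0 \<le> t" and "AE x in circle_measure. \<bar>\<phi> x - x\<bar> \<le> t" and "continuous_on UNIV \<phi>"
  shows "(LINT x|circle_measure. (norm (trig_poly F a (\<phi> x) - trig_poly F a x))\<^sup>2)
    \<le> 2 * t\<^sup>2 * (2 * pi * (\<Sum>n\<in>F. (norm (trig_deriv a n))\<^sup>2))"
proof -
  let ?v = "trig_poly F a" and ?v' = "trig_poly F (trig_deriv a)"
  define q where "q x = t * integral {-t..t} (\<lambda>s. (norm (?v' (x + s)))\<^sup>2)" for x
  define D where "D = 2 * pi * (\<Sum>n\<in>F. (norm (trig_deriv a n))\<^sup>2)"
  have cont2: "continuous_on UNIV (\<lambda>x. (norm (?v' x))\<^sup>2)"
    by (intro continuous_intros)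
  have intv: "(\<lambda>x. (norm (?v' x))\<^sup>2) integrable_on {c..d}" for c d
    using cont2 by (intro integrable_continuous_real) (auto intro: continuous_on_subset)
  have incr: "(norm (?v d - ?v c))\<^sup>2 \<le> (d - c) * integral {c..d} (\<lambda>x. (norm (?v' x))\<^sup>2)" if "c \<le> d" for c d
  proof -
    have "(?v' has_integral (?v d - ?v c)) {c..d}"
      using that trig_poly_has_derivative
      by (intro fundamental_theorem_of_calculus) (auto intro: has_vector_derivative_at_within)
    then have "integral {c..d} ?v' = ?v d - ?v c"
      by (rule integral_unique)
    then show ?thesis
      using integral_cauchy_schwarz[of c d ?v'] that by (simp add: continuous_on_trig_poly)
  qed
  have pointwise: "(norm (?v y - ?v x))\<^sup>2 \<le> q x" if "\<bar>y - x\<bar> \<le> t" for x y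
  proof -
    define c where "c = min x y"
    define d where "d = max x y"
    have cd: "c \<le> d" "d - c \<le> t" "{c..d} \<subseteq> {x - t..x + t}"
      using that \<open>0 \<le> t\<close> by (auto simp: c_def d_def min_def max_def)
    have "(norm (?v y - ?v x))\<^sup>2 = (norm (?v d - ?v c))\<^sup>2"
      by (simp add: c_def d_def min_def max_def norm_minus_commute)
    also have "\<dots> \<le> (d - c) * integral {c..d} (\<lambda>x. (norm (?v' x))\<^sup>2)"
      using \<open>c \<le> d\<close> by (rule incr)
    also have "\<dots> \<le> t * integral {x - t..x + t} (\<lambda>x. (norm (?v' x))\<^sup>2)"
      using cd \<open>0 \<le> t\<close> intv by (intro mult_mono integral_subset_le Henstock_Kurzweil_Integration.integral_nonneg) auto
    also have "integral {x - t..x + t} (\<lambda>x. (norm (?v' x))\<^sup>2) = integral {-t..t} (\<lambda>s. (norm (?v' (x + s)))\<^sup>2)"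
      using integral_shift_Icc_real[of "-t" t "\<lambda>x. (norm (?v' x))\<^sup>2" x] by (simp add: o_def add.commute)
    finally show ?thesis
      by (simp add: q_def)
  qed
  have joint: "continuous_on (cbox (0, -t) (2 * pi, t)) (\<lambda>(x, s). (norm (?v' (x + s)))\<^sup>2)"
    unfolding split_beta by (intro continuous_intros continuous_on_compose2[OF continuous_on_trig_poly[of UNIV]]) auto
  \<comment> \<open>A translation multiplies the coefficients by numbers of modulus 1, so Parseval
    gives the same value \<open>D\<close> for every \<open>s\<close>.\<close>
  have inner: "integral {0..2 * pi} (\<lambda>x. (norm (?v' (x + s)))\<^sup>2) = D" for s
  proof -
    have "?v' (x + s) = trig_poly F (\<lambda>n. trig_deriv a n * cis (of_int n * s)) x" for x
      by (simp add: trig_poly_def mult.assoc cis_mult algebra_simps)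
    moreover have "integral {0..2 * pi} (\<lambda>x. (norm (trig_poly F (\<lambda>n. trig_deriv a n * cis (of_int n * s)) x))\<^sup>2) = D"
      using integral_trig_poly_norm_square[OF \<open>finite F\<close>, of "\<lambda>n. trig_deriv a n * cis (of_int n * s)"]
      by (subst (asm) lebesgue_integral_eq_integral)
        (auto simp: D_def norm_mult intro!: continuous_integrable_circle continuous_intros)
    ultimately show ?thesis
      by simp
  qed
  have contq: "continuous_on {0..2 * pi} q"
    unfolding q_def using integral_continuous_on_param[OF joint[unfolded cbox_Pair_eq]]
    by (intro continuous_intros) simp
  have "(LINT x|circle_measure. q x) = integral {0..2 * pi} q"
    using continuous_imp_integrable_real[OF contq] by (rule lebesgue_integral_eq_integral) simp
  also have "\<dots> = t * integral {0..2 * pi} (\<lambda>x. integral {-t..t} (\<lambda>s. (norm (?v' (x + s)))\<^sup>2))"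
    by (simp add: q_def[abs_def])
  also have "integral {0..2 * pi} (\<lambda>x. integral {-t..t} (\<lambda>s. (norm (?v' (x + s)))\<^sup>2))
      = integral {-t..t} (\<lambda>s. integral {0..2 * pi} (\<lambda>x. (norm (?v' (x + s)))\<^sup>2))"
    using integral_swap_continuous[OF joint] by simp
  also have "\<dots> = 2 * t * D"
    using \<open>0 \<le> t\<close> by (simp add: inner)
  finally have "(LINT x|circle_measure. q x) = 2 * t\<^sup>2 * D"
    by (simp add: power2_eq_square)
  moreover have "(LINT x|circle_measure. (norm (?v (\<phi> x) - ?v x))\<^sup>2) \<le> (LINT x|circle_measure. q x)"
  proof (rule integral_mono_AE)
    show "integrable circle_measure (\<lambda>x. (norm (?v (\<phi> x) - ?v x))\<^sup>2)"
      by (intro continuous_integrable_circle continuous_intros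
          continuous_on_compose2[OF continuous_on_trig_poly[of UNIV] assms(4)]) auto
    show "integrable circle_measure q"
      using contq by (rule continuous_imp_integrable_real)
    show "AE x in circle_measure. (norm (?v (\<phi> x) - ?v x))\<^sup>2 \<le> q x"
      using assms(3) by eventually_elim (rule pointwise)
  qed
  ultimately show ?thesis
    by (simp add: D_def)
qed

subsection \<open>Composition with a bi-Lipschitz circle map\<close>

lemma lipschitz_increasing_deriv_nonneg:
  fixes f :: "real \<Rightarrow> real"
  assumes "strict_mono f" "(f has_real_derivative D) (at x)"
  shows "0 \<le> D"
proof -
  have "(\<lambda>n. real (Suc n) *\<^sub>R (f (x + 1 / real (Suc n)) - f x)) \<longlonglongrightarrow> D"
    using assms(2) unfolding has_real_derivative_iff_has_vector_derivative by (rule LIMSEQ_derivative)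
  moreover have "0 \<le> real (Suc n) *\<^sub>R (f (x + 1 / real (Suc n)) - f x)" for n
    using assms(1) by (simp add: strict_mono_less_eq)
  ultimately show ?thesis
    using LIMSEQ_le_const by blast
qed

locale circle_diffeo =
  fixes \<phi> :: "real \<Rightarrow> real"
  assumes diffeo: "W1inf_diffeo \<phi>"
begin

text \<open>The single size parameter of all estimates: it dominates both |\<phi>(x) - x| and
  |\<phi>'(x) - 1| almost everywhere.\<close>

definition disp :: real where
  "disp = W1inf_norm (\<lambda>\<theta>. \<phi> \<theta> - \<theta>)"

lemma period: "\<phi> (x + 2 * pi) = \<phi> x + 2 * pi"
  and hom: "homeomorphism UNIV UNIV \<phi> (inv \<phi>)"
  and mono: "strict_mono \<phi>"
  and lip: "\<exists>L. L-lipschitz_on UNIV \<phi>"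
  and lip_inv: "\<exists>L. L-lipschitz_on UNIV (inv \<phi>)"
  using diffeo by (auto simp: W1inf_diffeo_def)

lemma cont: "continuous_on UNIV \<phi>"
  using hom by (simp add: homeomorphism_def)

lemma AE_deriv: "AE x in circle_measure. (\<phi> has_real_derivative deriv \<phi> x) (at x)"
proof -
  have "AE x in lebesgue. (\<phi> has_real_derivative deriv \<phi> x) (at x)"
    using lip increasing_lipschitz_AE_differentiable[OF hom mono] by blast
  then show ?thesis
    by (subst AE_restrict_space_iff) auto
qed

lemma AE_deriv_nonneg: "AE x in circle_measure. 0 \<le> deriv \<phi> x"
  using AE_deriv by eventually_elim (rule lipschitz_increasing_deriv_nonneg[OF mono])

text \<open>\<open>W1inf_norm\<close> is a sum of two nonnegative essential suprema and so dominates
  each; almost everywhere the derivative of the displacement is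
  \<open>deriv \<phi> x - 1\<close>.\<close>

lemma disp_nonneg: "0 \<le> disp"
  and AE_disp: "AE x in circle_measure. \<bar>\<phi> x - x\<bar> \<le> disp"
  and AE_deriv_disp: "AE x in circle_measure. \<bar>deriv \<phi> x - 1\<bar> \<le> disp"
proof -
  define \<psi> where "\<psi> = (\<lambda>x. \<phi> x - x)"
  obtain L where L: "L-lipschitz_on UNIV \<phi>"
    using lip by blast
  have lip\<psi>: "(L + 1)-lipschitz_on UNIV \<psi>"
    unfolding \<psi>_def using L by (intro lipschitz_on_diff lipschitz_on_id)
  have der: "AE x in circle_measure. (\<psi> has_real_derivative deriv \<phi> x - 1) (at x)"
    using AE_deriv by eventually_elim (auto simp: \<psi>_def intro!: derivative_eq_intros)
  then have der_eq: "AE x in circle_measure. deriv \<psi> x = deriv \<phi> x - 1"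
    by eventually_elim (rule DERIV_imp_deriv)
  have der': "AE x in circle_measure. (\<psi> has_real_derivative deriv \<psi> x) (at x)"
    using der by eventually_elim (simp add: DERIV_imp_deriv)
  have cont\<psi>: "continuous_on UNIV \<psi>"
    using lip\<psi> by (rule lipschitz_on_continuous_on)
  have "bounded (\<psi> ` {0..2 * pi})"
    by (intro compact_imp_bounded compact_continuous_image continuous_on_subset[OF cont\<psi>]) auto
  then obtain B where "\<forall>x\<in>{0..2 * pi}. \<bar>\<psi> x\<bar> \<le> B"
    unfolding bounded_iff by auto
  then have "AE x in circle_measure. \<bar>\<psi> x\<bar> \<le> B"
    by (intro AE_I2) auto
  note 1 = Linf_norm_bound[OF continuous_measurable_circle[OF cont\<psi>] this]
  note 2 = Linf_norm_bound[OF lipschitz_AE_deriv[OF lip\<psi> der']]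
  have disp: "disp = Linf_norm \<psi> + Linf_norm (deriv \<psi>)"
    by (simp add: disp_def W1inf_norm_def \<psi>_def)
  show "0 \<le> disp"
    using 1(1) 2(1) by (simp add: disp)
  show "AE x in circle_measure. \<bar>\<phi> x - x\<bar> \<le> disp"
    using 1(2)
  proof eventually_elim
    case (elim x)
    then show ?case
      using 2(1) unfolding disp by (simp add: \<psi>_def)
  qed
  show "AE x in circle_measure. \<bar>deriv \<phi> x - 1\<bar> \<le> disp"
    using 2(2) der_eq
  proof eventually_elim
    case (elim x)
    then show ?case
      using 1(1) unfolding disp by simp
  qed
qed

text \<open>For an antiderivative \<open>Q\<close> of \<open>q\<close>, the function Q o \<phi> is
  Lipschitz with derivative q(\<phi>) \<phi>' almost everywhere, so the integral is the increment of
  \<open>Q\<close> from \<phi>(0) to \<phi>(0) + 2 pi. Periodicity of \<open>q\<close> makes this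
  increment independent of the starting point. The bound on \<open>q\<close> is what makes
  \<open>Q\<close> Lipschitz.\<close>

lemma substitution:
  fixes q :: "real \<Rightarrow> real"
  assumes contq: "continuous_on UNIV q" and per: "\<And>x. q (x + 2 * pi) = q x" and bound: "\<And>x. \<bar>q x\<bar> \<le> B"
  shows "integrable circle_measure (\<lambda>x. q (\<phi> x) * deriv \<phi> x)"
    "(LINT x|circle_measure. q (\<phi> x) * deriv \<phi> x) = (LINT x|circle_measure. q x)"
proof -
  have "\<exists>Q. \<forall>x::real. - \<infinity> < ereal x \<longrightarrow> ereal x < \<infinity> \<longrightarrow> (Q has_vector_derivative q x) (at x)"
    using contq by (intro einterval_antiderivative) (auto simp: continuous_on_eq_continuous_at)
  then obtain Q where Q: "\<And>x. (Q has_vector_derivative q x) (at x)"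
    by auto
  have Qd: "(Q has_real_derivative q x) (at x)" for x
    using Q by (simp add: has_real_derivative_iff_has_vector_derivative)
  have lipQ: "B-lipschitz_on UNIV Q"
    using Q bound by (intro vector_derivative_bounded_imp_lipschitz) auto
  have const: "Q (x + 2 * pi) - Q x = Q (y + 2 * pi) - Q y" for x y
  proof (rule DERIV_isconst_all[where f = "\<lambda>x. Q (x + 2 * pi) - Q x"])
    show "\<forall>x. ((\<lambda>x. Q (x + 2 * pi) - Q x) has_real_derivative 0) (at x)"
    proof
      fix x
      have "((\<lambda>x. Q (x + 2 * pi) - Q x) has_real_derivative (q (x + 2 * pi) * 1 - q x)) (at x)"
        by (intro DERIV_diff Qd DERIV_chain2[OF Qd]) (auto intro!: derivative_eq_intros)
      then show "((\<lambda>x. Q (x + 2 * pi) - Q x) has_real_derivative 0) (at x)"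
        by (simp add: per)
    qed
  qed
  obtain L where L: "L-lipschitz_on UNIV \<phi>"
    using lip by blast
  have lipQ\<phi>: "(B * L)-lipschitz_on UNIV (\<lambda>x. Q (\<phi> x))"
    using L lipschitz_on_subset[OF lipQ] by (intro lipschitz_on_compose2) auto
  have der: "AE x in circle_measure. ((\<lambda>x. Q (\<phi> x)) has_vector_derivative q (\<phi> x) * deriv \<phi> x) (at x)"
    using AE_deriv
    by eventually_elim (simp add: DERIV_chain2[OF Qd] flip: has_real_derivative_iff_has_vector_derivative)
  note int = lipschitz_AE_derivative_integral[OF lipQ\<phi> _ der]
  show "integrable circle_measure (\<lambda>x. q (\<phi> x) * deriv \<phi> x)"
    using int(1) by simp
  have "(LINT x|circle_measure. q (\<phi> x) * deriv \<phi> x) = Q (\<phi> (2 * pi)) - Q (\<phi> 0)"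
    using int(2) by simp
  also have "\<dots> = Q (2 * pi) - Q 0"
    using const[of "\<phi> 0" 0] period[of 0] by simp
  also have "\<dots> = (LINT x|circle_measure. q x)"
    using Q by (subst lipschitz_AE_derivative_integral(2)[OF lipQ]) auto
  finally show "(LINT x|circle_measure. q (\<phi> x) * deriv \<phi> x) = (LINT x|circle_measure. q x)" .
qed

lemma trig_poly_substitution:
  shows "integrable circle_measure (\<lambda>x. (norm (trig_poly F a (\<phi> x)))\<^sup>2 * deriv \<phi> x)"
    "(LINT x|circle_measure. (norm (trig_poly F a (\<phi> x)))\<^sup>2 * deriv \<phi> x)
      = (LINT x|circle_measure. (norm (trig_poly F a x))\<^sup>2)"
proof -
  have "continuous_on UNIV (\<lambda>x. (norm (trig_poly F a x))\<^sup>2)"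
    by (intro continuous_intros)
  moreover have "\<bar>(norm (trig_poly F a x))\<^sup>2\<bar> \<le> (\<Sum>n\<in>F. norm (a n))\<^sup>2" for x
    by (auto intro!: power_mono norm_trig_poly_le)
  ultimately show "integrable circle_measure (\<lambda>x. (norm (trig_poly F a (\<phi> x)))\<^sup>2 * deriv \<phi> x)"
    "(LINT x|circle_measure. (norm (trig_poly F a (\<phi> x)))\<^sup>2 * deriv \<phi> x)
      = (LINT x|circle_measure. (norm (trig_poly F a x))\<^sup>2)"
    using substitution[of "\<lambda>x. (norm (trig_poly F a x))\<^sup>2" "(\<Sum>n\<in>F. norm (a n))\<^sup>2"]
    by (simp_all add: trig_poly_periodic)
qed

lemma continuous_on_trig_poly_comp [continuous_intros]: "continuous_on A (\<lambda>x. trig_poly F a (\<phi> x))"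
  by (rule continuous_on_compose2[OF continuous_on_trig_poly[of UNIV] continuous_on_subset[OF cont]]) auto

text \<open>The threshold 1/2 originates here: it gives \<open>1 \<le> 2 * deriv \<phi> x\<close>
  almost everywhere, so the Jacobian can be inserted at the price of a factor 2.\<close>

lemma trig_poly_comp_bound:
  assumes "disp \<le> 1 / 2"
  shows "(LINT x|circle_measure. (norm (trig_poly F a (\<phi> x)))\<^sup>2)
    \<le> 2 * (LINT x|circle_measure. (norm (trig_poly F a x))\<^sup>2)"
proof -
  have "(LINT x|circle_measure. (norm (trig_poly F a (\<phi> x)))\<^sup>2)
      \<le> (LINT x|circle_measure. 2 * ((norm (trig_poly F a (\<phi> x)))\<^sup>2 * deriv \<phi> x))"
  proof (rule integral_mono_AE)
    show "integrable circle_measure (\<lambda>x. (norm (trig_poly F a (\<phi> x)))\<^sup>2)"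
      by (intro continuous_integrable_circle continuous_intros)
    show "integrable circle_measure (\<lambda>x. 2 * ((norm (trig_poly F a (\<phi> x)))\<^sup>2 * deriv \<phi> x))"
      by (intro integrable_mult_right trig_poly_substitution)
    show "AE x in circle_measure. (norm (trig_poly F a (\<phi> x)))\<^sup>2 \<le> 2 * ((norm (trig_poly F a (\<phi> x)))\<^sup>2 * deriv \<phi> x)"
      using AE_deriv_disp
    proof eventually_elim
      case (elim x)
      then have "1 \<le> 2 * deriv \<phi> x"
        using assms by linarith
      then have "(norm (trig_poly F a (\<phi> x)))\<^sup>2 * 1 \<le> (norm (trig_poly F a (\<phi> x)))\<^sup>2 * (2 * deriv \<phi> x)"
        by (rule mult_left_mono) simp
      then show ?case
        by (simp add: mult_ac)
    qed
  qed
  also have "\<dots> = 2 * (LINT x|circle_measure. (norm (trig_poly F a x))\<^sup>2)"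
    by (simp add: trig_poly_substitution)
  finally show ?thesis .
qed

section \<open>The composition difference, its derivative and its Fourier coefficients\<close>

definition diff_poly :: "int set \<Rightarrow> (int \<Rightarrow> complex) \<Rightarrow> real \<Rightarrow> complex" where
  "diff_poly F a x = trig_poly F a (\<phi> x) - trig_poly F a x"

text \<open>The chain rule derivative of \<open>diff_poly\<close>. At points where
  \<open>\<phi>\<close> is not differentiable its value has no meaning, but these points form a null
  set.\<close>

definition diff_deriv :: "int set \<Rightarrow> (int \<Rightarrow> complex) \<Rightarrow> real \<Rightarrow> complex" where
  "diff_deriv F a x = deriv \<phi> x *\<^sub>R trig_poly F (trig_deriv a) (\<phi> x) - trig_poly F (trig_deriv a) x"

lemma diff_poly_lipschitz: "\<exists>L. L-lipschitz_on UNIV (diff_poly F a)"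
proof -
  obtain L where L: "L-lipschitz_on UNIV \<phi>"
    using lip by blast
  have "((\<Sum>n\<in>F. norm (trig_deriv a n)) * L)-lipschitz_on UNIV (\<lambda>x. trig_poly F a (\<phi> x))"
    using L lipschitz_on_subset[OF trig_poly_lipschitz] by (rule lipschitz_on_compose2) simp
  then show ?thesis
    unfolding diff_poly_def[abs_def] using lipschitz_on_diff[OF _ trig_poly_lipschitz] by blast
qed

lemma AE_diff_deriv: "AE x in circle_measure. (diff_poly F a has_vector_derivative diff_deriv F a x) (at x)"
  using AE_deriv
proof eventually_elim
  case (elim x)
  then have "(\<phi> has_vector_derivative deriv \<phi> x) (at x)"
    by (simp add: has_real_derivative_iff_has_vector_derivative)
  then have "((trig_poly F a \<circ> \<phi>) has_vector_derivative deriv \<phi> x *\<^sub>R trig_poly F (trig_deriv a) (\<phi> x)) (at x)"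
    by (rule vector_diff_chain_at) (rule trig_poly_has_derivative)
  then have "((\<lambda>x. trig_poly F a (\<phi> x) - trig_poly F a x) has_vector_derivative diff_deriv F a x) (at x)"
    unfolding diff_deriv_def o_def by (intro has_vector_derivative_diff trig_poly_has_derivative)
  then show ?case
    by (simp add: diff_poly_def[abs_def])
qed

lemma diff_deriv_integrable: "integrable circle_measure (diff_deriv F a)"
proof -
  obtain L where "L-lipschitz_on UNIV (diff_poly F a)"
    using diff_poly_lipschitz by blast
  then show ?thesis
    by (rule lipschitz_AE_derivative_integral(1)[OF _ _ AE_diff_deriv]) simp
qed

lemma diff_deriv_square_integrable: "integrable circle_measure (\<lambda>x. (norm (diff_deriv F a x))\<^sup>2)"
proof (rule finite_measure.integrable_const_bound[OF finite_measure_circle])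
  define S where "S = (\<Sum>n\<in>F. norm (trig_deriv a n))"
  show "AE x in circle_measure. norm ((norm (diff_deriv F a x))\<^sup>2) \<le> ((1 + disp) * S + S)\<^sup>2"
    using AE_deriv_disp AE_deriv_nonneg
  proof eventually_elim
    case (elim x)
    have "norm (diff_deriv F a x) \<le> \<bar>deriv \<phi> x\<bar> * norm (trig_poly F (trig_deriv a) (\<phi> x)) + norm (trig_poly F (trig_deriv a) x)"
      unfolding diff_deriv_def by (rule order_trans[OF norm_triangle_ineq4]) simp
    also have "\<dots> \<le> (1 + disp) * S + S"
      using elim disp_nonneg norm_trig_poly_le[of F "trig_deriv a"]
      by (intro add_mono mult_mono) (auto simp: S_def)
    finally show ?case
      by (simp add: power_mono)
  qed
  show "(\<lambda>x. (norm (diff_deriv F a x))\<^sup>2) \<in> borel_measurable circle_measure"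
    using borel_measurable_integrable[OF diff_deriv_integrable] by measurable
qed

text \<open>Integration by parts: \<open>diff_poly\<close> times an exponential is Lipschitz and has
  equal values at 0 and 2 pi, so its almost everywhere derivative integrates to 0.\<close>

lemma fourier_coeff_diff_deriv: "fourier_coeff (diff_deriv F a) n = \<i> * of_int n * fourier_coeff (diff_poly F a) n"
proof -
  let ?e = "\<lambda>x. cis (- of_int n * x)"
  obtain L where L: "L-lipschitz_on UNIV (diff_poly F a)"
    using diff_poly_lipschitz by blast
  have bound: "norm (diff_poly F a x) \<le> (\<Sum>n\<in>F. norm (a n)) + (\<Sum>n\<in>F. norm (a n))" for x
    unfolding diff_poly_def by (rule order_trans[OF norm_triangle_ineq4]) (intro add_mono norm_trig_poly_le)
  have lipW: "(((\<Sum>n\<in>F. norm (a n)) + (\<Sum>n\<in>F. norm (a n))) * \<bar>- of_int n\<bar> + L * 1)-lipschitz_on UNIV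
      (\<lambda>x. diff_poly F a x * ?e x)"
    by (rule lipschitz_on_mult_bounded[OF L bound cis_lipschitz]) simp
  have der: "AE x in circle_measure. ((\<lambda>x. diff_poly F a x * ?e x) has_vector_derivative
      diff_poly F a x * (\<i> * complex_of_real (- of_int n) * ?e x) + diff_deriv F a x * ?e x) (at x)"
    using AE_diff_deriv by eventually_elim (intro has_vector_derivative_mult has_vector_derivative_cis_mult)
  have "(LINT x|circle_measure. diff_poly F a x * (\<i> * complex_of_real (- of_int n) * ?e x) + diff_deriv F a x * ?e x)
      = diff_poly F a (2 * pi) * ?e (2 * pi) - diff_poly F a 0 * ?e 0"
    using lipschitz_AE_derivative_integral(2)[OF lipW _ der] by simp
  also have "\<dots> = 0"
  proof -
    have "?e (2 * pi) = 1"
      using cis_multiple_2pi[of "of_int (- n)"] by (simp add: mult_ac)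
    moreover have "diff_poly F a (2 * pi) = diff_poly F a 0"
      using period[of 0] trig_poly_periodic[of F a "\<phi> 0"] trig_poly_periodic[of F a 0] by (simp add: diff_poly_def)
    ultimately show ?thesis
      by simp
  qed
  finally have zero: "(LINT x|circle_measure. diff_poly F a x * (\<i> * complex_of_real (- of_int n) * ?e x)
      + diff_deriv F a x * ?e x) = 0" .
  have eq: "(\<lambda>x. diff_poly F a x * (\<i> * complex_of_real (- of_int n) * ?e x) + diff_deriv F a x * ?e x)
      = (\<lambda>x. diff_deriv F a x * cis (- (of_int n * x)) - \<i> * of_int n * (diff_poly F a x * cis (- (of_int n * x))))"
    by (simp add: algebra_simps)
  have int1: "integrable circle_measure (\<lambda>x. diff_poly F a x * cis (- (of_int n * x)))"
    unfolding diff_poly_def by (intro continuous_integrable_circle continuous_intros)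
  have "integrable circle_measure (\<lambda>x. cis (- of_int n * x) * diff_deriv F a x)"
    by (intro bounded_measurable_times_integrable_circle[where B = 1] diff_deriv_integrable
        continuous_measurable_circle continuous_intros) simp
  then have int2: "integrable circle_measure (\<lambda>x. diff_deriv F a x * cis (- (of_int n * x)))"
    by (simp add: mult.commute)
  have "(LINT x|circle_measure. diff_deriv F a x * cis (- (of_int n * x)))
      = \<i> * of_int n * (LINT x|circle_measure. diff_poly F a x * cis (- (of_int n * x)))"
    using zero integrable_mult_right[OF int1, of "\<i> * of_int n"] int2 unfolding eq
    by (simp add: Bochner_Integration.integral_diff del: integrable_mult_right)
  then show ?thesis
    by (simp add: fourier_coeff_def)
qed

text \<open>Bessel's inequality for the derivative. Passing from |n| to n^2 gives away half a
  derivative, which regularity above order one can afford.\<close>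

lemma diff_poly_coeff_bound:
  assumes "finite G"
  shows "2 * pi * (\<Sum>n\<in>G. of_int \<bar>n\<bar> * (norm (fourier_coeff (diff_poly F a) n))\<^sup>2)
    \<le> (LINT x|circle_measure. (norm (diff_deriv F a x))\<^sup>2)"
proof -
  have "of_int \<bar>n\<bar> * (norm (fourier_coeff (diff_poly F a) n))\<^sup>2 \<le> (norm (fourier_coeff (diff_deriv F a) n))\<^sup>2" for n
  proof -
    have "real_of_int \<bar>n\<bar> \<le> (of_int \<bar>n\<bar>)\<^sup>2"
    proof (cases "n = 0")
      case False
      then have "1 \<le> real_of_int \<bar>n\<bar>"
        by linarith
      then show ?thesis
        by (rule self_le_power) simp
    qed simp
    then show ?thesis
      by (simp add: fourier_coeff_diff_deriv norm_mult power_mult_distrib mult_right_mono)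
  qed
  then have "2 * pi * (\<Sum>n\<in>G. of_int \<bar>n\<bar> * (norm (fourier_coeff (diff_poly F a) n))\<^sup>2)
      \<le> 2 * pi * (\<Sum>n\<in>G. (norm (fourier_coeff (diff_deriv F a) n))\<^sup>2)"
    by (intro mult_left_mono sum_mono) auto
  also have "\<dots> \<le> (LINT x|circle_measure. (norm (diff_deriv F a x))\<^sup>2)"
    using assms by (intro fourier_coeff_bessel borel_measurable_integrable diff_deriv_integrable diff_deriv_square_integrable)
  finally show ?thesis .
qed

end

section \<open>Frequency weights and the two regimes of the displacement\<close>

text \<open>With m = |n| and t the displacement, the three bounds serve the term carrying \<phi>' -
  1, the low frequencies and the high ones. They rest on x^2 \<le> x^(2\<delta>) for 0 \<le> x \<le>
  1, taken at x = t and x = m t, and on x^(2\<delta>) \<ge> 1 for x = m t \<ge> 1.\<close>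

lemma sobolev_weight_bounds:
  fixes m t :: real
  assumes "0 \<le> m" "0 \<le> t" "t \<le> 1" "0 < \<delta>" "\<delta> < 1"
  shows "t\<^sup>2 * m\<^sup>2 \<le> t powr (2 * \<delta>) * (1 + m\<^sup>2) powr (1 + \<delta>)"
    and "m * t \<le> 1 \<Longrightarrow> t\<^sup>2 * (m\<^sup>2)\<^sup>2 \<le> t powr (2 * \<delta>) * (1 + m\<^sup>2) powr (1 + \<delta>)"
    and "1 \<le> m * t \<Longrightarrow> m\<^sup>2 \<le> t powr (2 * \<delta>) * (1 + m\<^sup>2) powr (1 + \<delta>)"
proof -
  \<comment> \<open>The left side is the homogeneous part of the Sobolev weight; it absorbs the
    power of \<open>m\<close> contained in (m t)^(2\<delta>).\<close>
  have split: "m\<^sup>2 * m powr (2 * \<delta>) \<le> (1 + m\<^sup>2) powr (1 + \<delta>)"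
  proof -
    have "m powr (2 * \<delta>) = (m\<^sup>2) powr \<delta>"
      using assms by (cases "m = 0") (auto simp: powr_powr simp flip: powr_numeral)
    also have "\<dots> \<le> (1 + m\<^sup>2) powr \<delta>"
      using assms by (intro powr_mono2) auto
    finally have "m\<^sup>2 * m powr (2 * \<delta>) \<le> (1 + m\<^sup>2) * (1 + m\<^sup>2) powr \<delta>"
      by (intro mult_mono) auto
    also have "\<dots> = (1 + m\<^sup>2) powr (1 + \<delta>)"
      by (simp add: powr_add add_pos_nonneg)
    finally show ?thesis .
  qed
  have sq: "x\<^sup>2 \<le> x powr (2 * \<delta>)" if "0 \<le> x" "x \<le> 1" for x :: real
  proof (cases "x = 0")
    case False
    then have "x powr 2 \<le> x powr (2 * \<delta>)"
      using that assms by (intro powr_mono') auto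
    then show ?thesis
      using that False by simp
  qed simp
  have "m\<^sup>2 \<le> 1 + m\<^sup>2"
    by simp
  also have "\<dots> = (1 + m\<^sup>2) powr 1"
    by (simp add: add_pos_nonneg)
  also have "\<dots> \<le> (1 + m\<^sup>2) powr (1 + \<delta>)"
    using assms by (intro powr_mono) auto
  finally show "t\<^sup>2 * m\<^sup>2 \<le> t powr (2 * \<delta>) * (1 + m\<^sup>2) powr (1 + \<delta>)"
    using sq[of t] assms by (intro mult_mono) auto
  show "t\<^sup>2 * (m\<^sup>2)\<^sup>2 \<le> t powr (2 * \<delta>) * (1 + m\<^sup>2) powr (1 + \<delta>)" if "m * t \<le> 1"
  proof -
    have "t\<^sup>2 * (m\<^sup>2)\<^sup>2 = m\<^sup>2 * (m * t)\<^sup>2"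
      by (simp add: power2_eq_square mult_ac)
    also have "\<dots> \<le> m\<^sup>2 * (m * t) powr (2 * \<delta>)"
      using sq[of "m * t"] that assms by (intro mult_left_mono) auto
    also have "\<dots> = t powr (2 * \<delta>) * (m\<^sup>2 * m powr (2 * \<delta>))"
      using assms by (simp add: powr_mult)
    also have "\<dots> \<le> t powr (2 * \<delta>) * (1 + m\<^sup>2) powr (1 + \<delta>)"
      using split by (intro mult_left_mono) auto
    finally show ?thesis .
  qed
  show "m\<^sup>2 \<le> t powr (2 * \<delta>) * (1 + m\<^sup>2) powr (1 + \<delta>)" if "1 \<le> m * t"
  proof -
    have "m\<^sup>2 * 1 \<le> m\<^sup>2 * (m * t) powr (2 * \<delta>)"
      using that assms by (intro mult_left_mono ge_one_powr_ge_zero) auto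
    also have "\<dots> = t powr (2 * \<delta>) * (m\<^sup>2 * m powr (2 * \<delta>))"
      using assms by (simp add: powr_mult)
    also have "\<dots> \<le> t powr (2 * \<delta>) * (1 + m\<^sup>2) powr (1 + \<delta>)"
      using split by (intro mult_left_mono) auto
    finally show ?thesis
      by simp
  qed
qed

context circle_diffeo
begin

text \<open>In |\<phi>' v(\<phi>)|^2 one factor \<phi>' is bounded by 1 + disp and the other is
  consumed by the substitution, so the growth is linear and not quadratic: 4 + 2 disp = 2 (1 + disp)
  + 2.\<close>

lemma diff_deriv_bound:
  assumes "finite F"
  shows "(LINT x|circle_measure. (norm (diff_deriv F a x))\<^sup>2)
    \<le> (4 + 2 * disp) * (2 * pi * (\<Sum>n\<in>F. (norm (trig_deriv a n))\<^sup>2))"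
proof -
  let ?v = "trig_poly F (trig_deriv a)"
  have int: "integrable circle_measure (\<lambda>x. (norm (?v x))\<^sup>2)"
    by (intro continuous_integrable_circle continuous_intros)
  have "(LINT x|circle_measure. (norm (diff_deriv F a x))\<^sup>2)
      \<le> (LINT x|circle_measure. 2 * (1 + disp) * ((norm (?v (\<phi> x)))\<^sup>2 * deriv \<phi> x) + 2 * (norm (?v x))\<^sup>2)"
  proof (rule integral_mono_AE[OF diff_deriv_square_integrable])
    show "integrable circle_measure (\<lambda>x. 2 * (1 + disp) * ((norm (?v (\<phi> x)))\<^sup>2 * deriv \<phi> x) + 2 * (norm (?v x))\<^sup>2)"
      by (intro Bochner_Integration.integrable_add integrable_mult_right trig_poly_substitution int)
    show "AE x in circle_measure. (norm (diff_deriv F a x))\<^sup>2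
        \<le> 2 * (1 + disp) * ((norm (?v (\<phi> x)))\<^sup>2 * deriv \<phi> x) + 2 * (norm (?v x))\<^sup>2"
      using AE_deriv_disp AE_deriv_nonneg
    proof eventually_elim
      case (elim x)
      have "(norm (diff_deriv F a x))\<^sup>2 \<le> 2 * (norm (deriv \<phi> x *\<^sub>R ?v (\<phi> x)))\<^sup>2 + 2 * (norm (?v x))\<^sup>2"
        using norm_square_triangle[of "deriv \<phi> x *\<^sub>R ?v (\<phi> x)" "- ?v x"] by (simp add: diff_deriv_def)
      moreover have "(norm (deriv \<phi> x *\<^sub>R ?v (\<phi> x)))\<^sup>2 \<le> (1 + disp) * ((norm (?v (\<phi> x)))\<^sup>2 * deriv \<phi> x)"
      proof -
        have "deriv \<phi> x * ((norm (?v (\<phi> x)))\<^sup>2 * deriv \<phi> x) \<le> (1 + disp) * ((norm (?v (\<phi> x)))\<^sup>2 * deriv \<phi> x)"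
          using elim by (intro mult_right_mono) auto
        then show ?thesis
          by (simp add: power_mult_distrib power2_eq_square mult_ac)
      qed
      ultimately show ?case
        by (simp only: mult.assoc)
    qed
  qed
  also have "\<dots> = 2 * (1 + disp) * (LINT x|circle_measure. (norm (?v x))\<^sup>2) + 2 * (LINT x|circle_measure. (norm (?v x))\<^sup>2)"
    using int trig_poly_substitution[of F "trig_deriv a"] by simp
  also have "\<dots> = (4 + 2 * disp) * (2 * pi * (\<Sum>n\<in>F. (norm (trig_deriv a n))\<^sup>2))"
    unfolding integral_trig_poly_norm_square[OF assms] by (simp add: algebra_simps)
  finally show ?thesis .
qed

text \<open>The factor 6 is 2 * 2 + 2. No power of the displacement is gained, so the bound is meant
  for frequencies high enough that the weight supplies one.\<close>

lemma trig_poly_diff_high: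
  assumes "disp \<le> 1 / 2" "finite F"
  shows "(LINT x|circle_measure. (norm (trig_poly F a (\<phi> x) - trig_poly F a x))\<^sup>2)
    \<le> 6 * (2 * pi * (\<Sum>n\<in>F. (norm (a n))\<^sup>2))"
proof -
  let ?v = "trig_poly F a"
  have "(LINT x|circle_measure. (norm (?v (\<phi> x) - ?v x))\<^sup>2)
      \<le> (LINT x|circle_measure. 2 * (norm (?v (\<phi> x)))\<^sup>2 + 2 * (norm (?v x))\<^sup>2)"
  proof (rule integral_mono)
    show "integrable circle_measure (\<lambda>x. (norm (?v (\<phi> x) - ?v x))\<^sup>2)"
      "integrable circle_measure (\<lambda>x. 2 * (norm (?v (\<phi> x)))\<^sup>2 + 2 * (norm (?v x))\<^sup>2)"
      by (intro continuous_integrable_circle continuous_intros)+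
    show "(norm (?v (\<phi> x) - ?v x))\<^sup>2 \<le> 2 * (norm (?v (\<phi> x)))\<^sup>2 + 2 * (norm (?v x))\<^sup>2" for x
      using norm_square_triangle[of "?v (\<phi> x)" "- ?v x"] by simp
  qed
  also have "\<dots> = 2 * (LINT x|circle_measure. (norm (?v (\<phi> x)))\<^sup>2) + 2 * (LINT x|circle_measure. (norm (?v x))\<^sup>2)"
  proof -
    have "integrable circle_measure (\<lambda>x. (norm (?v (\<phi> x)))\<^sup>2)" "integrable circle_measure (\<lambda>x. (norm (?v x))\<^sup>2)"
      by (intro continuous_integrable_circle continuous_intros)+
    then show ?thesis
      by simp
  qed
  also have "\<dots> \<le> 6 * (LINT x|circle_measure. (norm (?v x))\<^sup>2)"
    using trig_poly_comp_bound[OF assms(1), of F a] by simp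
  finally show ?thesis
    using assms by (simp add: integral_trig_poly_norm_square)
qed

text \<open>The operator \<open>v \<mapsto> v \<circ> \<phi> - v\<close> is bounded on square integrable functions and of size
  \<open>disp\<close> from one derivative to none; cutting the frequencies at \<open>1 / disp\<close> interpolates between
  the two.\<close>

lemma diff_deriv_bound_small:
  assumes small: "disp \<le> 1 / 2" and F: "finite F" and \<delta>: "0 < \<delta>" "\<delta> < 1"
  shows "(LINT x|circle_measure. (norm (diff_deriv F a x))\<^sup>2)
    \<le> 28 * disp powr (2 * \<delta>) * (2 * pi * (\<Sum>n\<in>F. (1 + (of_int \<bar>n\<bar>)\<^sup>2) powr (1 + \<delta>) * (norm (a n))\<^sup>2))"
proof -
  define b where "b = trig_deriv a"
  \<comment> \<open>In product form the cut avoids dividing by the displacement; if that is 0, every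
    frequency counts as low.\<close>
  define Fl where "Fl = {n\<in>F. of_int \<bar>n\<bar> * disp \<le> 1}"
  define Fh where "Fh = F - Fl"
  let ?T = "\<lambda>F x. trig_poly F b (\<phi> x) - trig_poly F b x"
  have fin: "finite Fl" "finite Fh"
    using F by (auto simp: Fl_def Fh_def)
  have split: "sum f F = sum f Fl + sum f Fh" for f :: "int \<Rightarrow> 'b::comm_monoid_add"
    unfolding Fh_def using sum.subset_diff[of Fl F f] F by (auto simp: Fl_def add.commute)
  have T: "?T F x = ?T Fl x + ?T Fh x" for x
    by (simp add: trig_poly_def split)
  have intT: "integrable circle_measure (\<lambda>x. (norm (?T E x))\<^sup>2)" for E
    by (intro continuous_integrable_circle continuous_intros)
  have intC: "integrable circle_measure (\<lambda>x. (norm (trig_poly F b (\<phi> x)))\<^sup>2)"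
    by (intro continuous_integrable_circle continuous_intros)
  have weight:
    "disp\<^sup>2 * (of_int \<bar>n\<bar>)\<^sup>2 * (norm (a n))\<^sup>2
      \<le> disp powr (2 * \<delta>) * (1 + (of_int \<bar>n\<bar>)\<^sup>2) powr (1 + \<delta>) * (norm (a n))\<^sup>2"
    "of_int \<bar>n\<bar> * disp \<le> 1 \<Longrightarrow> disp\<^sup>2 * ((of_int \<bar>n\<bar>)\<^sup>2)\<^sup>2 * (norm (a n))\<^sup>2
      \<le> disp powr (2 * \<delta>) * (1 + (of_int \<bar>n\<bar>)\<^sup>2) powr (1 + \<delta>) * (norm (a n))\<^sup>2"
    "1 \<le> of_int \<bar>n\<bar> * disp \<Longrightarrow> (of_int \<bar>n\<bar>)\<^sup>2 * (norm (a n))\<^sup>2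
      \<le> disp powr (2 * \<delta>) * (1 + (of_int \<bar>n\<bar>)\<^sup>2) powr (1 + \<delta>) * (norm (a n))\<^sup>2" for n
    using small disp_nonneg \<delta>
    by (intro mult_right_mono sobolev_weight_bounds; simp)+
  have nonneg: "0 \<le> disp powr (2 * \<delta>) * (1 + (of_int \<bar>n\<bar>)\<^sup>2) powr (1 + \<delta>) * (norm (a n))\<^sup>2" for n
    by simp
  \<comment> \<open>The inequality |p + q|^2 \<le> 2 |p|^2 + 2 |q|^2 is used twice, whence the
    factors 2 and 4: once to split off the term with \<phi>' - 1, once to separate low from high
    frequencies.\<close>
  have "(LINT x|circle_measure. (norm (diff_deriv F a x))\<^sup>2)
      \<le> (LINT x|circle_measure. 2 * disp\<^sup>2 * (norm (trig_poly F b (\<phi> x)))\<^sup>2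
          + 4 * (norm (?T Fl x))\<^sup>2 + 4 * (norm (?T Fh x))\<^sup>2)"
  proof (rule integral_mono_AE[OF diff_deriv_square_integrable])
    show "integrable circle_measure (\<lambda>x. 2 * disp\<^sup>2 * (norm (trig_poly F b (\<phi> x)))\<^sup>2
          + 4 * (norm (?T Fl x))\<^sup>2 + 4 * (norm (?T Fh x))\<^sup>2)"
      by (intro Bochner_Integration.integrable_add integrable_mult_right intT intC)
    show "AE x in circle_measure. (norm (diff_deriv F a x))\<^sup>2 \<le> 2 * disp\<^sup>2 * (norm (trig_poly F b (\<phi> x)))\<^sup>2
          + 4 * (norm (?T Fl x))\<^sup>2 + 4 * (norm (?T Fh x))\<^sup>2"
      using AE_deriv_disp
    proof eventually_elim
      case (elim x)
      have "diff_deriv F a x = (deriv \<phi> x - 1) *\<^sub>R trig_poly F b (\<phi> x) + ?T F x"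
        by (simp add: diff_deriv_def b_def algebra_simps)
      then have "(norm (diff_deriv F a x))\<^sup>2 \<le> 2 * (norm ((deriv \<phi> x - 1) *\<^sub>R trig_poly F b (\<phi> x)))\<^sup>2 + 2 * (norm (?T F x))\<^sup>2"
        using norm_square_triangle by metis
      moreover have "(norm (?T F x))\<^sup>2 \<le> 2 * (norm (?T Fl x))\<^sup>2 + 2 * (norm (?T Fh x))\<^sup>2"
        unfolding T by (rule norm_square_triangle)
      moreover have "(norm ((deriv \<phi> x - 1) *\<^sub>R trig_poly F b (\<phi> x)))\<^sup>2 \<le> disp\<^sup>2 * (norm (trig_poly F b (\<phi> x)))\<^sup>2"
        using elim power_mono[OF elim, of 2] by (auto simp: power_mult_distrib intro!: mult_right_mono)
      ultimately show ?case
        by linarith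
    qed
  qed
  also have "\<dots> = 2 * disp\<^sup>2 * (LINT x|circle_measure. (norm (trig_poly F b (\<phi> x)))\<^sup>2)
      + 4 * (LINT x|circle_measure. (norm (?T Fl x))\<^sup>2) + 4 * (LINT x|circle_measure. (norm (?T Fh x))\<^sup>2)"
    using intT intC by simp
  \<comment> \<open>The low frequencies spend a second derivative to gain the square of the
    displacement; the high ones are bounded without any gain.\<close>
  also have "\<dots> \<le> 2 * disp\<^sup>2 * (2 * (2 * pi * (\<Sum>n\<in>F. (norm (b n))\<^sup>2)))
      + 4 * (2 * disp\<^sup>2 * (2 * pi * (\<Sum>n\<in>Fl. (norm (trig_deriv b n))\<^sup>2)))
      + 4 * (6 * (2 * pi * (\<Sum>n\<in>Fh. (norm (b n))\<^sup>2)))"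
  proof (intro add_mono mult_left_mono)
    show "(LINT x|circle_measure. (norm (trig_poly F b (\<phi> x)))\<^sup>2) \<le> 2 * (2 * pi * (\<Sum>n\<in>F. (norm (b n))\<^sup>2))"
      using trig_poly_comp_bound[OF small, of F b] F by (simp add: integral_trig_poly_norm_square)
    show "(LINT x|circle_measure. (norm (?T Fl x))\<^sup>2) \<le> 2 * disp\<^sup>2 * (2 * pi * (\<Sum>n\<in>Fl. (norm (trig_deriv b n))\<^sup>2))"
      using fin(1) disp_nonneg AE_disp cont by (rule displacement_bound)
    show "(LINT x|circle_measure. (norm (?T Fh x))\<^sup>2) \<le> 6 * (2 * pi * (\<Sum>n\<in>Fh. (norm (b n))\<^sup>2))"
      using small fin(2) by (rule trig_poly_diff_high)
  qed auto
  also have "\<dots> = 2 * pi * ((\<Sum>n\<in>Fl. 4 * disp\<^sup>2 * (norm (b n))\<^sup>2 + 8 * disp\<^sup>2 * (norm (trig_deriv b n))\<^sup>2)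
      + (\<Sum>n\<in>Fh. 4 * disp\<^sup>2 * (norm (b n))\<^sup>2 + 24 * (norm (b n))\<^sup>2))"
    unfolding split by (simp add: sum.distrib sum_distrib_left[symmetric] algebra_simps)
  \<comment> \<open>The high frequencies give 28 = 4 + 24; the low ones give 4 + 8 = 12, which the
    same constant dominates.\<close>
  also have "\<dots> \<le> 2 * pi * ((\<Sum>n\<in>Fl. 28 * disp powr (2 * \<delta>) * ((1 + (of_int \<bar>n\<bar>)\<^sup>2) powr (1 + \<delta>) * (norm (a n))\<^sup>2))
      + (\<Sum>n\<in>Fh. 28 * disp powr (2 * \<delta>) * ((1 + (of_int \<bar>n\<bar>)\<^sup>2) powr (1 + \<delta>) * (norm (a n))\<^sup>2)))"
  proof (intro mult_left_mono add_mono sum_mono)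
    fix n assume "n \<in> Fl"
    show "4 * disp\<^sup>2 * (norm (b n))\<^sup>2 + 8 * disp\<^sup>2 * (norm (trig_deriv b n))\<^sup>2
        \<le> 28 * disp powr (2 * \<delta>) * ((1 + (of_int \<bar>n\<bar>)\<^sup>2) powr (1 + \<delta>) * (norm (a n))\<^sup>2)"
    proof -
      have "of_int \<bar>n\<bar> * disp \<le> 1"
        using \<open>n \<in> Fl\<close> by (simp add: Fl_def)
      note weight(1)[of n] weight(2)[OF this]
      moreover have "4 * disp\<^sup>2 * (norm (b n))\<^sup>2 + 8 * disp\<^sup>2 * (norm (trig_deriv b n))\<^sup>2
          = 4 * (disp\<^sup>2 * (of_int \<bar>n\<bar>)\<^sup>2 * (norm (a n))\<^sup>2) + 8 * (disp\<^sup>2 * ((of_int \<bar>n\<bar>)\<^sup>2)\<^sup>2 * (norm (a n))\<^sup>2)"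
        by (simp add: b_def trig_deriv_def norm_mult power_mult_distrib)
      ultimately show ?thesis
        using nonneg[of n] by (simp only: mult.assoc)
    qed
  next
    fix n assume "n \<in> Fh"
    show "4 * disp\<^sup>2 * (norm (b n))\<^sup>2 + 24 * (norm (b n))\<^sup>2
        \<le> 28 * disp powr (2 * \<delta>) * ((1 + (of_int \<bar>n\<bar>)\<^sup>2) powr (1 + \<delta>) * (norm (a n))\<^sup>2)"
    proof -
      have "1 \<le> of_int \<bar>n\<bar> * disp"
        using \<open>n \<in> Fh\<close> by (auto simp: Fh_def Fl_def)
      note weight(1)[of n] weight(3)[OF this]
      moreover have "4 * disp\<^sup>2 * (norm (b n))\<^sup>2 + 24 * (norm (b n))\<^sup>2
          = 4 * (disp\<^sup>2 * (of_int \<bar>n\<bar>)\<^sup>2 * (norm (a n))\<^sup>2) + 24 * ((of_int \<bar>n\<bar>)\<^sup>2 * (norm (a n))\<^sup>2)"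
        by (simp add: b_def trig_deriv_def norm_mult power_mult_distrib)
      ultimately show ?thesis
        by (simp only: mult.assoc)
    qed
  qed auto
  also have "\<dots> = 28 * disp powr (2 * \<delta>) * (2 * pi * (\<Sum>n\<in>F. (1 + (of_int \<bar>n\<bar>)\<^sup>2) powr (1 + \<delta>) * (norm (a n))\<^sup>2))"
    unfolding split by (simp add: sum_distrib_left algebra_simps)
  finally show ?thesis .
qed

end

text \<open>The constant 64 exceeds 28 and is a perfect square. For 1/2 < t < 1 the left side is at
  most 6, while t^(2\<delta>') \<ge> t^2 \<ge> 1/4. For t \<ge> 1 it is at most 6 t, and the larger
  exponent in \<open>omega\<close> supplies t^(2\<delta>' + 1) \<ge> t.\<close>

lemma omega_bounds:
  assumes "0 < \<delta>'" "\<delta>' < \<delta>" "\<delta> < 1" "0 \<le> t"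
  shows "0 \<le> omega \<delta>' t"
    and "t \<le> 1 / 2 \<Longrightarrow> 28 * t powr (2 * \<delta>) \<le> 64 * (omega \<delta>' t)\<^sup>2"
    and "1 / 2 < t \<Longrightarrow> 4 + 2 * t \<le> 64 * (omega \<delta>' t)\<^sup>2"
proof -
  have ge: "t powr (\<delta>' + 1 / 2) \<le> omega \<delta>' t" "t powr \<delta>' \<le> omega \<delta>' t"
    by (auto simp: omega_def)
  show nn: "0 \<le> omega \<delta>' t"
    using ge(2) by (rule order_trans[rotated]) simp
  have sq: "t powr (2 * d) = (t powr d)\<^sup>2" for d
    by (simp add: powr_add[symmetric] power2_eq_square)
  have ge2: "t powr (2 * \<delta>') \<le> (omega \<delta>' t)\<^sup>2"
    unfolding sq using ge by (intro power_mono) auto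
  show "28 * t powr (2 * \<delta>) \<le> 64 * (omega \<delta>' t)\<^sup>2" if "t \<le> 1 / 2"
  proof -
    have "t powr (2 * \<delta>) \<le> t powr (2 * \<delta>')"
      using assms that by (intro powr_mono') auto
    also note ge2
    finally have "t powr (2 * \<delta>) \<le> (omega \<delta>' t)\<^sup>2" .
    then show ?thesis
      using zero_le_power2[of "omega \<delta>' t"] by linarith
  qed
  show "4 + 2 * t \<le> 64 * (omega \<delta>' t)\<^sup>2" if "1 / 2 < t"
  proof (cases "1 \<le> t")
    case True
    have "t = t powr 1"
      using that by simp
    also have "\<dots> \<le> t powr (2 * (\<delta>' + 1 / 2))"
      using True assms by (intro powr_mono) auto
    also have "\<dots> \<le> (omega \<delta>' t)\<^sup>2"
      unfolding sq using ge by (intro power_mono) auto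
    finally show ?thesis
      using True by linarith
  next
    case False
    have "1 / 4 \<le> t\<^sup>2"
      using power_mono[of "1 / 2" t 2] that by (simp add: power2_eq_square)
    also have "\<dots> = t powr 2"
      using that by simp
    also have "\<dots> \<le> t powr (2 * \<delta>')"
      using False that assms by (intro powr_mono') auto
    also note ge2
    finally show ?thesis
      using False by linarith
  qed
qed

subsection \<open>Passage to the limit\<close>

lemma fourier_coeff_trig_poly:
  assumes "finite F"
  shows "fourier_coeff (trig_poly F a) n = (if n \<in> F then a n else 0)"
proof -
  have "trig_poly F a x * cis (- (of_int n * x)) = (\<Sum>m\<in>F. a m * cis (of_int (m - n) * x))" for x
    unfolding trig_poly_def sum_distrib_right
    by (intro sum.cong refl) (simp add: mult.assoc cis_mult left_diff_distrib)
  moreover have int: "integrable circle_measure (\<lambda>x. a m * cis (of_int (m - n) * x))" for m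
    by (intro continuous_integrable_circle continuous_intros)
  ultimately have "(LINT x|circle_measure. trig_poly F a x * cis (- (of_int n * x)))
      = (\<Sum>m\<in>F. LINT x|circle_measure. a m * cis (of_int (m - n) * x))"
    by (simp only: Bochner_Integration.integral_sum)
  also have "\<dots> = (\<Sum>m\<in>F. if m = n then 2 * pi * a n else 0)"
    by (intro sum.cong refl) (simp add: integral_cis_circle del: of_int_diff)
  also have "\<dots> = (if n \<in> F then 2 * pi * a n else 0)"
    using assms by simp
  finally show ?thesis
    by (simp add: fourier_coeff_def scaleR_conv_of_real)
qed

text \<open>Bounded convergence: the constant \<open>B\<close> is integrable over one period and
  exponentials have modulus 1.\<close>

lemma fourier_coeff_tendsto:
  assumes p: "\<And>k. p k \<in> borel_measurable circle_measure" and q: "q \<in> borel_measurable circle_measure"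
    and lim: "\<And>x. (\<lambda>k. p k x) \<longlonglongrightarrow> q x" and bound: "\<And>k x. norm (p k x) \<le> B"
  shows "(\<lambda>k. fourier_coeff (p k) n) \<longlonglongrightarrow> fourier_coeff q n"
  unfolding fourier_coeff_def
proof (intro tendsto_scaleR tendsto_const integral_dominated_convergence[where w = "\<lambda>_. B"])
  have e: "(\<lambda>x. cis (- (of_int n * x))) \<in> borel_measurable circle_measure"
    by (intro continuous_measurable_circle continuous_intros)
  show "(\<lambda>x. q x * cis (- (of_int n * x))) \<in> borel_measurable circle_measure"
    using q e by (rule borel_measurable_times)
  show "(\<lambda>x. p k x * cis (- (of_int n * x))) \<in> borel_measurable circle_measure" for k
    using p e by (rule borel_measurable_times)
  show "integrable circle_measure (\<lambda>_. B)"
    by (intro continuous_integrable_circle continuous_intros)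
  show "AE x in circle_measure. (\<lambda>k. p k x * cis (- (of_int n * x))) \<longlonglongrightarrow> q x * cis (- (of_int n * x))"
    by (intro AE_I2 tendsto_mult lim tendsto_const)
  show "AE x in circle_measure. norm (p k x * cis (- (of_int n * x))) \<le> B" for k
    using bound by (simp add: norm_mult)
qed

lemma fourier_coeff_diff:
  assumes "integrable circle_measure f" "integrable circle_measure g"
  shows "fourier_coeff (\<lambda>x. f x - g x) n = fourier_coeff f n - fourier_coeff g n"
proof -
  have "integrable circle_measure (\<lambda>x. h x * cis (- (of_int n * x)))" if "integrable circle_measure h" for h
  proof -
    have "integrable circle_measure (\<lambda>x. cis (- (of_int n * x)) * h x)"
      using that by (intro bounded_measurable_times_integrable_circle[where B = 1]
          continuous_measurable_circle continuous_intros) auto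
    then show ?thesis
      by (simp add: mult.commute)
  qed
  then show ?thesis
    using assms by (simp add: fourier_coeff_def left_diff_distrib scaleR_diff_right)
qed

lemma fourier_coeff_cong_AE:
  assumes "f \<in> borel_measurable circle_measure" "g \<in> borel_measurable circle_measure"
    and "AE x in circle_measure. f x = g x"
  shows "fourier_coeff f n = fourier_coeff g n"
proof -
  have e: "(\<lambda>x. cis (- (of_int n * x))) \<in> borel_measurable circle_measure"
    by (intro continuous_measurable_circle continuous_intros)
  have "(LINT x|circle_measure. f x * cis (- (of_int n * x))) = (LINT x|circle_measure. g x * cis (- (of_int n * x)))"
    by (rule integral_cong_AE) (use assms e in \<open>auto intro: borel_measurable_times\<close>)
  then show ?thesis
    by (simp add: fourier_coeff_def)
qed

section \<open>Absolute convergence of the Fourier series\<close>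

lemma summable_on_int_inverse_square: "(\<lambda>n::int. 1 / (1 + (of_int \<bar>n\<bar>)\<^sup>2) :: real) summable_on UNIV"
proof -
  let ?f = "\<lambda>n::int. 1 / (1 + (of_int \<bar>n\<bar>)\<^sup>2) :: real"
  have "summable (\<lambda>n::nat. 1 / (1 + (real n)\<^sup>2))"
  proof (rule summable_comparison_test'[OF inverse_power_summable[of 2, where 'a = real]])
    fix n :: nat assume "n \<ge> 1"
    then show "norm (1 / (1 + (real n)\<^sup>2)) \<le> inverse (of_nat n ^ 2)"
      using le_imp_inverse_le[of "(real n)\<^sup>2" "1 + (real n)\<^sup>2"] by (simp add: inverse_eq_divide abs_of_nonneg)
  qed simp
  then have "(\<lambda>n::nat. 1 / (1 + (real n)\<^sup>2)) summable_on UNIV"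
    by (subst summable_on_UNIV_nonneg_real_iff) simp_all
  then have "?f summable_on (range int)" "?f summable_on (range (\<lambda>n. - int n))"
    by (subst summable_on_reindex; simp add: o_def inj_on_def)+
  then have "?f summable_on (range int \<union> range (\<lambda>n. - int n))"
    by (rule summable_on_union)
  moreover have "range int \<union> range (\<lambda>n. - int n) = UNIV"
  proof -
    have "n \<in> range int \<union> range (\<lambda>n. - int n)" for n
      by (cases n rule: int_cases2) auto
    then show ?thesis
      by blast
  qed
  ultimately show ?thesis
    by simp
qed

text \<open>With w = 1 + n^2, the bound c \<le> 1/w + w c^2 replaces Cauchy-Schwarz: the first term
  is summable, and since w \<le> w^s the second is dominated by a term of the Sobolev sum.\<close>

lemma H_space_coeff_summable:
  assumes "u \<in> H_space s" "1 \<le> s"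
  shows "(\<lambda>n. norm (fourier_coeff u n)) summable_on UNIV"
proof (rule summable_on_comparison_test)
  show "(\<lambda>n::int. 1 / (1 + (of_int \<bar>n\<bar>)\<^sup>2) + (1 + (of_int \<bar>n\<bar>)\<^sup>2) powr s * (norm (fourier_coeff u n))\<^sup>2) summable_on UNIV"
    using assms(1) by (intro summable_on_add summable_on_int_inverse_square) (simp add: H_space_def)
  fix n :: int
  define c where "c = norm (fourier_coeff u n)"
  define w where "w = 1 + (real_of_int \<bar>n\<bar>)\<^sup>2"
  have w: "1 \<le> w"
    by (simp add: w_def)
  have "c \<le> 1 / w + w * c\<^sup>2"
  proof -
    \<comment> \<open>Expanded, this is 1 - w c + w^2 c^2, that is, \<open>w\<close> times the
      difference to be shown nonnegative.\<close>
    have "0 \<le> (1 - w * c)\<^sup>2 + w * c"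
      using w by (simp add: c_def)
    also have "\<dots> = w * (1 / w + w * c\<^sup>2 - c)"
      using w by (simp add: power2_eq_square algebra_simps)
    finally show ?thesis
      using w by (simp add: zero_le_mult_iff)
  qed
  also have "w \<le> w powr s"
    using powr_mono[of 1 s w] assms(2) w by simp
  then have "1 / w + w * c\<^sup>2 \<le> 1 / w + w powr s * c\<^sup>2"
    by (intro add_left_mono mult_right_mono) auto
  finally show "norm (fourier_coeff u n)
      \<le> 1 / (1 + (of_int \<bar>n\<bar>)\<^sup>2) + (1 + (of_int \<bar>n\<bar>)\<^sup>2) powr s * (norm (fourier_coeff u n))\<^sup>2"
    by (simp add: c_def w_def)
qed simp

text \<open>Absolute convergence yields a bounded function defined at every point with the
  coefficients of \<open>u\<close>, and uniqueness identifies the two almost everywhere. Convergence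
  at every point is what makes composition with \<open>\<phi>\<close> harmless.\<close>

lemma H_space_fourier_series:
  assumes u: "u \<in> H_space s" and "1 \<le> s"
  obtains f S where "\<And>x. (\<lambda>N. trig_poly {- int N..int N} (fourier_coeff u) x) \<longlonglongrightarrow> f x"
    "\<And>F x. finite F \<Longrightarrow> norm (trig_poly F (fourier_coeff u) x) \<le> S"
    "AE x in circle_measure. u x = f x"
proof -
  define c where "c = fourier_coeff u"
  define S where "S = (\<Sum>\<^sub>\<infinity>n. norm (c n))"
  define f where "f x = (\<Sum>\<^sub>\<infinity>n. c n * cis (of_int n * x))" for x
  let ?p = "\<lambda>N. trig_poly {- int N..int N} c"
  have sum: "(\<lambda>n. norm (c n)) summable_on UNIV"
    unfolding c_def using assms by (rule H_space_coeff_summable)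
  have bound: "norm (trig_poly F c x) \<le> S" if "finite F" for F x
    using norm_trig_poly_le finite_sum_le_infsum[OF sum that] unfolding S_def by (rule order_trans) auto
  \<comment> \<open>The symmetric ranges are cofinal among the finite sets of integers, so the
    unordered sum is the limit of the symmetric partial sums.\<close>
  have "filterlim (\<lambda>N. {- int N..int N}) (finite_subsets_at_top UNIV) sequentially"
    unfolding filterlim_finite_subsets_at_top
  proof (intro allI impI)
    fix X :: "int set" assume X: "finite X \<and> X \<subseteq> UNIV"
    define K where "K = Max (insert 0 ((\<lambda>n. nat \<bar>n\<bar>) ` X))"
    have "X \<subseteq> {- int N..int N}" if "K \<le> N" for N
    proof
      fix n assume "n \<in> X"
      then have "nat \<bar>n\<bar> \<le> K"
        unfolding K_def using X by (intro Max_ge) auto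
      then show "n \<in> {- int N..int N}"
        using that by auto
    qed
    then show "\<forall>\<^sub>F N in sequentially. finite {- int N..int N} \<and> X \<subseteq> {- int N..int N} \<and> {- int N..int N} \<subseteq> UNIV"
      unfolding eventually_sequentially by auto
  qed
  moreover have "(\<lambda>n. c n * cis (of_int n * x)) summable_on UNIV" for x
    by (rule abs_summable_summable) (use sum in \<open>simp add: norm_mult\<close>)
  then have "((\<lambda>F. \<Sum>n\<in>F. c n * cis (of_int n * x)) \<longlongrightarrow> f x) (finite_subsets_at_top UNIV)" for x
    unfolding f_def has_sum_def[symmetric] by (rule has_sum_infsum)
  ultimately have lim: "(\<lambda>N. ?p N x) \<longlonglongrightarrow> f x" for x
    unfolding trig_poly_def using filterlim_compose by blast
  have measp: "?p N \<in> borel_measurable circle_measure" for N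
    by (intro continuous_measurable_circle continuous_intros)
  have measf: "f \<in> borel_measurable circle_measure"
    by (rule borel_measurable_LIMSEQ_metric[OF measp lim])
  have intf: "integrable circle_measure f"
  proof (rule finite_measure.integrable_const_bound[OF finite_measure_circle _ measf])
    have "norm (f x) \<le> S" for x
      using tendsto_norm[OF lim] by (rule LIMSEQ_le_const2) (use bound in auto)
    then show "AE x in circle_measure. norm (f x) \<le> S"
      by simp
  qed
  have coeff: "fourier_coeff f n = c n" for n
  proof -
    have "(\<lambda>N. fourier_coeff (?p N) n) \<longlonglongrightarrow> fourier_coeff f n"
      using measp measf lim by (rule fourier_coeff_tendsto) (use bound in auto)
    moreover have "\<forall>\<^sub>F N in sequentially. fourier_coeff (?p N) n = c n"
      unfolding eventually_sequentially by (rule exI[of _ "nat \<bar>n\<bar>"]) (auto simp: fourier_coeff_trig_poly)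
    then have "(\<lambda>N. fourier_coeff (?p N) n) \<longlonglongrightarrow> c n"
      by (rule tendsto_eventually)
    ultimately show ?thesis
      by (rule LIMSEQ_unique)
  qed
  have intu: "integrable circle_measure u"
    using u by (intro L2_imp_integrable_circle) (auto simp: H_space_def L2_circle_def)
  have "AE x in circle_measure. u x - f x = 0"
    using intu intf by (intro fourier_coeff_unique) (auto simp: fourier_coeff_diff coeff c_def)
  then have "AE x in circle_measure. u x = f x"
    by simp
  then show thesis
    using that[of f S] lim bound unfolding c_def by blast
qed

context circle_diffeo
begin

text \<open>The two regimes merge into one bound that is independent of \<open>G\<close> and depends
  on \<open>F\<close> only through the Sobolev sum, so both sets may grow.\<close>

lemma diff_poly_half_bound:
  assumes fin: "finite F" "finite G" and \<delta>: "0 < \<delta>'" "\<delta>' < \<delta>" "\<delta> < 1"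
  shows "(\<Sum>n\<in>G. of_int \<bar>n\<bar> * (norm (fourier_coeff (diff_poly F a) n))\<^sup>2)
    \<le> 64 * (omega \<delta>' disp)\<^sup>2 * (\<Sum>n\<in>F. (1 + (of_int \<bar>n\<bar>)\<^sup>2) powr (1 + \<delta>) * (norm (a n))\<^sup>2)"
proof -
  define A where "A = (\<Sum>n\<in>F. (1 + (real_of_int \<bar>n\<bar>)\<^sup>2) powr (1 + \<delta>) * (norm (a n))\<^sup>2)"
  have "0 \<le> A"
    unfolding A_def by (intro sum_nonneg) auto
  have "(LINT x|circle_measure. (norm (diff_deriv F a x))\<^sup>2) \<le> 64 * (omega \<delta>' disp)\<^sup>2 * (2 * pi * A)"
  proof (cases "disp \<le> 1 / 2")
    case True
    have "(LINT x|circle_measure. (norm (diff_deriv F a x))\<^sup>2) \<le> 28 * disp powr (2 * \<delta>) * (2 * pi * A)"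
      unfolding A_def using True fin \<delta> by (intro diff_deriv_bound_small) auto
    also have "\<dots> \<le> 64 * (omega \<delta>' disp)\<^sup>2 * (2 * pi * A)"
      using omega_bounds(2)[OF \<delta> disp_nonneg True] \<open>0 \<le> A\<close> by (intro mult_right_mono) auto
    finally show ?thesis .
  next
    case False
    have "(\<Sum>n\<in>F. (norm (trig_deriv a n))\<^sup>2) \<le> A"
      unfolding A_def
    proof (intro sum_mono)
      fix n
      \<comment> \<open>The first weight bound at t = 1.\<close>
      have "(real_of_int \<bar>n\<bar>)\<^sup>2 \<le> (1 + (real_of_int \<bar>n\<bar>)\<^sup>2) powr (1 + \<delta>)"
        using sobolev_weight_bounds(1)[of "real_of_int \<bar>n\<bar>" 1 \<delta>] \<delta> by simp
      then show "(norm (trig_deriv a n))\<^sup>2 \<le> (1 + (of_int \<bar>n\<bar>)\<^sup>2) powr (1 + \<delta>) * (norm (a n))\<^sup>2"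
        by (simp add: trig_deriv_def norm_mult power_mult_distrib mult_right_mono)
    qed
    then have "(4 + 2 * disp) * (2 * pi * (\<Sum>n\<in>F. (norm (trig_deriv a n))\<^sup>2)) \<le> (4 + 2 * disp) * (2 * pi * A)"
      using disp_nonneg by (intro mult_left_mono) auto
    also have "\<dots> \<le> 64 * (omega \<delta>' disp)\<^sup>2 * (2 * pi * A)"
      using omega_bounds(3)[OF \<delta> disp_nonneg] False \<open>0 \<le> A\<close> by (intro mult_right_mono) auto
    finally show ?thesis
      using diff_deriv_bound[OF fin(1), of a] by linarith
  qed
  with diff_poly_coeff_bound[OF fin(2), of F a]
  have "2 * pi * (\<Sum>n\<in>G. of_int \<bar>n\<bar> * (norm (fourier_coeff (diff_poly F a) n))\<^sup>2)
      \<le> 64 * (omega \<delta>' disp)\<^sup>2 * (2 * pi * A)"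
    by (rule order_trans)
  also have "\<dots> = 2 * pi * (64 * (omega \<delta>' disp)\<^sup>2 * A)"
    by simp
  finally show ?thesis
    unfolding A_def by (rule mult_left_le_imp_le) simp
qed

text \<open>Since \<open>\<phi>\<close> need not map [0, 2 pi] into itself, the exceptional set is
  first spread over the line by all translations by multiples of 2 pi. Its preimage under
  \<open>\<phi>\<close> is null because the inverse of \<open>\<phi>\<close> is Lipschitz.\<close>

lemma AE_comp_cong:
  assumes u: "\<And>x. u (x + 2 * pi) = u x" and v: "\<And>x. v (x + 2 * pi) = v x"
    and ae: "AE x in circle_measure. u x = v x"
  shows "AE x in circle_measure. u (\<phi> x) = v (\<phi> x)"
proof -
  have per: "w (x + 2 * pi * of_int k) = w x" if w: "\<And>x. w (x + 2 * pi) = w x" for w :: "real \<Rightarrow> 'b" and x k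
  proof (induction k rule: int_induct[of _ 0])
    case (step1 k)
    then show ?case
      using w[of "x + 2 * pi * of_int k"] by (simp add: algebra_simps)
  next
    case (step2 k)
    then show ?case
      using w[of "x + 2 * pi * of_int (k - 1)"] by (simp add: algebra_simps)
  qed simp
  have "AE x in lebesgue. x \<in> {0..2 * pi} \<longrightarrow> u x = v x"
    using ae by (subst (asm) AE_restrict_space_iff) auto
  then obtain N where N: "negligible N" "\<And>x. x \<in> {0..2 * pi} \<Longrightarrow> x \<notin> N \<Longrightarrow> u x = v x"
    unfolding completion.AE_iff_null_sets negligible_iff_null_sets by auto
  define M where "M = (\<Union>k::int. (\<lambda>x. x + 2 * pi * of_int k) ` N)"
  have "negligible ((\<lambda>x. x + 2 * pi * of_int k) ` N)" for k :: int
    using N(1) by (rule lipschitz_negligible_image[where L = 1, rotated]) (auto intro!: lipschitz_onI simp: dist_real_def)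
  then have "negligible M"
    unfolding M_def by (intro negligible_countable_Union) auto
  then have "negligible (inv \<phi> ` M)"
    using lip_inv lipschitz_negligible_image by blast
  then have "AE x in lebesgue. x \<notin> inv \<phi> ` M"
    using AE_not_in negligible_iff_null_sets by blast
  then have "AE x in lebesgue. u (\<phi> x) = v (\<phi> x)"
  proof eventually_elim
    case (elim x)
    then have "\<phi> x \<notin> M"
      using hom unfolding homeomorphism_def by force
    define k where "k = \<lfloor>\<phi> x / (2 * pi)\<rfloor>"
    define y where "y = \<phi> x - 2 * pi * of_int k"
    have y: "\<phi> x = y + 2 * pi * of_int k"
      by (simp add: y_def)
    have "y \<in> {0..2 * pi}"
    proof -
      have "of_int k \<le> \<phi> x / (2 * pi)" "\<phi> x / (2 * pi) \<le> of_int k + 1"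
        by (simp_all add: k_def)
      then show ?thesis
        by (auto simp: y_def field_simps)
    qed
    moreover have "y \<notin> N"
      using \<open>\<phi> x \<notin> M\<close> y by (auto simp: M_def)
    ultimately have "u y = v y"
      by (rule N(2))
    then show ?case
      unfolding y by (simp add: per[of u, OF u] per[of v, OF v])
  qed
  then show ?thesis
    by (subst AE_restrict_space_iff) auto
qed

text \<open>Lower semicontinuity: for a fixed finite set of frequencies the degree of the
  polynomials tends to infinity, and only then does the set grow. The bound on all finite sums
  yields membership in \<open>H_half_space\<close> together with the norm estimate.\<close>

lemma composition_estimate:
  assumes u: "u \<in> H_space (1 + \<delta>)" and \<delta>: "0 < \<delta>'" "\<delta>' < \<delta>" "\<delta> < 1"
  shows "(\<lambda>\<theta>. u (\<phi> \<theta>) - u \<theta>) \<in> H_half_space"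
    and "H_half_norm (\<lambda>\<theta>. u (\<phi> \<theta>) - u \<theta>) \<le> 8 * H_norm (1 + \<delta>) u * omega \<delta>' disp"
proof -
  define c where "c = fourier_coeff u"
  define w where "w = (\<lambda>\<theta>. u (\<phi> \<theta>) - u \<theta>)"
  define A where "A = (\<Sum>\<^sub>\<infinity>n::int. (1 + (of_int \<bar>n\<bar>)\<^sup>2) powr (1 + \<delta>) * (norm (c n))\<^sup>2)"
  let ?a = "\<lambda>n::int. of_int \<bar>n\<bar> * (norm (fourier_coeff w n))\<^sup>2 :: real"
  have sumA: "(\<lambda>n::int. (1 + (of_int \<bar>n\<bar>)\<^sup>2) powr (1 + \<delta>) * (norm (c n))\<^sup>2) summable_on UNIV"
    using u by (simp add: H_space_def c_def)
  have A: "(\<Sum>n\<in>F. (1 + (of_int \<bar>n\<bar>)\<^sup>2) powr (1 + \<delta>) * (norm (c n))\<^sup>2) \<le> A" if "finite F" for F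
    unfolding A_def using sumA that by (rule finite_sum_le_infsum) auto
  have "0 \<le> A"
    using A[of "{}"] by simp
  have per_u: "u (x + 2 * pi) = u x" for x
    using u by (simp add: H_space_def L2_circle_def periodic_2pi_def)
  obtain f S where lim: "\<And>x. (\<lambda>N. trig_poly {- int N..int N} c x) \<longlonglongrightarrow> f x"
    and S: "\<And>F x. finite F \<Longrightarrow> norm (trig_poly F c x) \<le> S" and uf: "AE x in circle_measure. u x = f x"
    using H_space_fourier_series[OF u] \<delta> unfolding c_def by auto
  have per_f: "f (x + 2 * pi) = f x" for x
    using lim[of "x + 2 * pi"] lim[of x] unfolding trig_poly_periodic by (rule LIMSEQ_unique)
  let ?p = "\<lambda>N. diff_poly {- int N..int N} c"
  \<comment> \<open>The limit of the polynomial differences at every point; it agrees with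
    \<open>w\<close> almost everywhere and hence has the same Fourier coefficients.\<close>
  define wf where "wf = (\<lambda>x. f (\<phi> x) - f x)"
  have limw: "(\<lambda>N. ?p N x) \<longlonglongrightarrow> wf x" for x
    unfolding diff_poly_def wf_def by (intro tendsto_diff lim)
  have measp: "?p N \<in> borel_measurable circle_measure" for N
    unfolding diff_poly_def by (intro continuous_measurable_circle continuous_intros)
  have meas_wf: "wf \<in> borel_measurable circle_measure"
    by (rule borel_measurable_LIMSEQ_metric[OF measp limw])
  have boundp: "norm (?p N x) \<le> S + S" for N x
    unfolding diff_poly_def by (rule order_trans[OF norm_triangle_ineq4]) (intro add_mono S; simp)
  have bound_wf: "norm (wf x) \<le> S + S" for x
    using tendsto_norm[OF limw] by (rule LIMSEQ_le_const2) (use boundp in auto)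
  have w_wf: "AE x in circle_measure. wf x = w x"
    using uf AE_comp_cong[OF per_u per_f uf] by eventually_elim (simp add: w_def wf_def)
  have meas_w: "w \<in> borel_measurable circle_measure"
    using meas_wf _ w_wf by (rule borel_measurable_AE_lebesgue_on) simp
  have "integrable circle_measure (\<lambda>x. (norm (w x))\<^sup>2)"
  proof (rule finite_measure.integrable_const_bound[OF finite_measure_circle])
    show "AE x in circle_measure. norm ((norm (w x))\<^sup>2) \<le> (S + S)\<^sup>2"
      using w_wf
    proof eventually_elim
      case (elim x)
      then have "(norm (w x))\<^sup>2 \<le> (S + S)\<^sup>2"
        using bound_wf[of x] by (intro power_mono) auto
      then show ?case
        by simp
    qed
    show "(\<lambda>x. (norm (w x))\<^sup>2) \<in> borel_measurable circle_measure"
      using meas_w by measurable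
  qed
  then have L2: "w \<in> L2_circle"
    using meas_w by (simp add: L2_circle_def periodic_2pi_def w_def per_u period)
  have coeff: "(\<lambda>N. fourier_coeff (?p N) n) \<longlonglongrightarrow> fourier_coeff w n" for n
    using fourier_coeff_tendsto[OF measp meas_wf limw boundp] fourier_coeff_cong_AE[OF meas_wf meas_w w_wf] by simp
  have partial: "sum ?a G \<le> 64 * (omega \<delta>' disp)\<^sup>2 * A" if "finite G" for G
  proof (rule LIMSEQ_le_const2)
    show "(\<lambda>N. \<Sum>n\<in>G. of_int \<bar>n\<bar> * (norm (fourier_coeff (?p N) n))\<^sup>2) \<longlonglongrightarrow> sum ?a G"
      by (intro tendsto_intros coeff)
    have "(\<Sum>n\<in>G. of_int \<bar>n\<bar> * (norm (fourier_coeff (?p N) n))\<^sup>2) \<le> 64 * (omega \<delta>' disp)\<^sup>2 * A" for N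
    proof -
      have "(\<Sum>n\<in>G. of_int \<bar>n\<bar> * (norm (fourier_coeff (?p N) n))\<^sup>2) \<le> 64 * (omega \<delta>' disp)\<^sup>2
          * (\<Sum>n\<in>{- int N..int N}. (1 + (of_int \<bar>n\<bar>)\<^sup>2) powr (1 + \<delta>) * (norm (c n))\<^sup>2)"
        using that \<delta> by (intro diff_poly_half_bound) auto
      also have "\<dots> \<le> 64 * (omega \<delta>' disp)\<^sup>2 * A"
        using A[of "{- int N..int N}"] by (intro mult_left_mono) auto
      finally show ?thesis .
    qed
    then show "\<exists>N0. \<forall>N\<ge>N0. (\<Sum>n\<in>G. of_int \<bar>n\<bar> * (norm (fourier_coeff (?p N) n))\<^sup>2) \<le> 64 * (omega \<delta>' disp)\<^sup>2 * A"
      by blast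
  qed
  have sumw: "?a summable_on UNIV"
    by (rule nonneg_bounded_partial_sums_imp_summable_on[where C = "64 * (omega \<delta>' disp)\<^sup>2 * A"])
      (use partial in \<open>auto intro!: eventually_finite_subsets_at_top_weakI\<close>)
  then show "(\<lambda>\<theta>. u (\<phi> \<theta>) - u \<theta>) \<in> H_half_space"
    using L2 by (simp add: H_half_space_def flip: w_def)
  have "infsum ?a UNIV \<le> 64 * (omega \<delta>' disp)\<^sup>2 * A"
    using sumw partial by (rule infsum_le_finite_sums)
  then have "sqrt (infsum ?a UNIV) \<le> sqrt (64 * (omega \<delta>' disp)\<^sup>2 * A)"
    by (rule real_sqrt_le_mono)
  \<comment> \<open>The factor 8 is the square root of 64; nonnegativity of \<open>omega\<close>
    lets it leave the root without an absolute value.\<close>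
  also have "\<dots> = 8 * sqrt A * omega \<delta>' disp"
    using omega_bounds(1)[OF \<delta> disp_nonneg] by (simp add: real_sqrt_mult)
  also have "sqrt A = H_norm (1 + \<delta>) u"
    by (simp add: H_norm_def A_def c_def)
  finally show "H_half_norm (\<lambda>\<theta>. u (\<phi> \<theta>) - u \<theta>) \<le> 8 * H_norm (1 + \<delta>) u * omega \<delta>' disp"
    by (simp add: H_half_norm_def flip: w_def)
qed

end

theorem theorem2p3:
  fixes \<delta> :: real
  assumes "0 < \<delta>" and "\<delta> < 1"
  shows "\<forall>\<delta>'\<in>{0<..<\<delta>}. \<exists>C>0. \<forall>u\<in>H_space (1 + \<delta>). \<forall>\<phi>. W1inf_diffeo \<phi> \<longrightarrow>
    (\<lambda>\<theta>. u (\<phi> \<theta>) - u \<theta>) \<in> H_half_space \<and>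
    H_half_norm (\<lambda>\<theta>. u (\<phi> \<theta>) - u \<theta>)
      \<le> C * H_norm (1 + \<delta>) u * omega \<delta>' (W1inf_norm (\<lambda>\<theta>. \<phi> \<theta> - \<theta>))"
proof (intro ballI exI[of _ 8] conjI allI impI)
  fix \<delta>' u \<phi>
  assume \<delta>': "\<delta>' \<in> {0<..<\<delta>}" and u: "u \<in> H_space (1 + \<delta>)" and \<phi>: "W1inf_diffeo \<phi>"
  interpret circle_diffeo \<phi>
    using \<phi> by unfold_locales
  show "(\<lambda>\<theta>. u (\<phi> \<theta>) - u \<theta>) \<in> H_half_space"
    using composition_estimate(1)[OF u, of \<delta>'] \<delta>' \<open>\<delta> < 1\<close> by simp
  show "H_half_norm (\<lambda>\<theta>. u (\<phi> \<theta>) - u \<theta>)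
      \<le> 8 * H_norm (1 + \<delta>) u * omega \<delta>' (W1inf_norm (\<lambda>\<theta>. \<phi> \<theta> - \<theta>))"
    using composition_estimate(2)[OF u, of \<delta>'] \<delta>' \<open>\<delta> < 1\<close> by (simp add: disp_def)
qed simp

end
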